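(* Let $n\ge1$ and let $\Omega\subset\mathbb{R}^n$ be a bounded domain with Lipschitz boundary. For $0<\delta<\delta_0$ let $a_1^\delta=\delta^{-1}\cosh^{-1}\big(1+\tfrac12\delta^2\lambda_1^\delta\big)$, where $\lambda_1^\delta$ is the first eigenvalue of the $\delta$-discrete Dirichlet problem for the Laplacian in $\Omega^\delta$. (i) There is a constant $C_\Omega>0$ depending only on $\Omega$ such that the following holds for every $0<\delta<\delta_0$ with $1/\delta\in\mathbb{N}$ and every positive integer $N$. Let $h:\overline{\Omega}^\delta\times([-N,N]\cap\delta\mathbb{Z})\to\mathbb{R}$ be $\delta$-discrete harmonic, i.e. $\Delta_{\delta,n+1}h=0$ on $\Omega^\delta\times((-N,N)\cap\delta\mathbb{Z})$, with boundary values $h=f$ on $\partial\Omega^\delta\times([-N,N]\cap\delta\mathbb{Z})$, and such that $|h(x',\pm N)|\le M_N$ for all $x'\in\Omega^\delta$. Then $$\max_{x'\in\Omega^\delta}|h(x',0)|\le\max|f|+C_\Omega\,(M_N+\max|f|)\exp(-a_1^\delta N),$$ where $\max|f|$ is taken over $\partial\Omega^\delta\times([-N,N]\cap\delta\mathbb{Z})$. (ii) In particular, let $0<\delta<\delta_0$ and let $h:\overline{\Omega}^\delta\times\delta\mathbb{Z}\to\mathbb{R}$ be $\delta$-discrete harmonic in $\Omega^\delta\times\delta\mathbb{Z}$, with $$|h(x',x_{n+1})|=o\big(\exp(a_1^\delta|x_{n+1}|)\big)\quad\text{when }|x_{n+1}|\to\infty .$$ If $h$ is bounded on the boundary $\partial\Omega^\delta\times\delta\mathbb{Z}$,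 then $h$ is bounded by the same constant in $\Omega^\delta\times\delta\mathbb{Z}$; that is, if $|h|\le B$ on $\partial\Omega^\delta\times\delta\mathbb{Z}$, then $|h|\le B$ on $\Omega^\delta\times\delta\mathbb{Z}$.
   Context: Two points of $(\delta\mathbb{Z})^m$ are neighbors if they differ by $\pm\delta e_j$ for some standard basis vector $e_j$. The $\delta$-discrete Laplacian on $(\delta\mathbb{Z})^m$ is $$\Delta_{\delta,m}u(x)=\delta^{-2}\Big(\sum_{j=1}^m\big(u(x+\delta e_j)+u(x-\delta e_j)\big)-2m\,u(x)\Big),$$ and a function is $\delta$-discrete harmonic at a point if its discrete Laplacian vanishes there. $\Omega^\delta=\Omega\cap(\delta\mathbb{Z})^n$; $\partial\Omega^\delta$ is the set of points of $(\delta\mathbb{Z})^n\setminus\Omega^\delta$ having at least one neighbor in $\Omega^\delta$; $\overline{\Omega}^\delta=\Omega^\delta\cup\partial\Omega^\delta$. The number $\delta_0>0$ is fixed, depending only on $\Omega$, so small that for $0<\delta<\delta_0$ the set $\Omega^\delta$ is a nonempty discrete domain, i.e. connected in the lattice (any two points are joined by a path of neighboring points in $\Omega^\delta$). Points of $(\delta\mathbb{Z})^{n+1}$ are written $(x',x_{n+1})$ with $x'\in(\delta\mathbb{Z})^n$. $\lambda_1^\delta>0$ is the smallest eigenvalue of the discrete Dirichlet problem $-\Delta_{\delta,n}f=\lambda f$ in $\Omega^\delta$, $f=0$ on $\partial\Omega^\delta$. $\cosh^{-1}$ denotes the inverse of $\cosh$ on $[0,\infty)$. The $o(\cdot)$ condition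 means: for every $\varepsilon>0$ there is $R>0$ such that $|h(x',x_{n+1})|\le\varepsilon\exp(a_1^\delta|x_{n+1}|)$ for all $x'\in\overline{\Omega}^\delta$ and all $x_{n+1}\in\delta\mathbb{Z}$ with $|x_{n+1}|\ge R$. *)

theory Defs
  imports "HOL-Analysis.Analysis"
begin

text \<open>
  All discrete notions are stated for an arbitrary Euclidean space, so that the same definitions
  serve the lattices in \<open>real ^ 'n\<close>, in \<open>real\<close>, and in \<open>(real ^ 'n) \<times> real\<close>; the latter plays the
  role of \<open>(n+1)\<close>-dimensional space, with points \<open>(x', t)\<close>.
\<close>

definition grid :: "real \<Rightarrow> 'a::euclidean_space set" where
  "grid \<delta> = {x. \<forall>b\<in>Basis. \<exists>k::int. x \<bullet> b = \<delta> * of_int k}"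

definition neighbors :: "real \<Rightarrow> 'a::euclidean_space \<Rightarrow> 'a \<Rightarrow> bool" where
  "neighbors \<delta> x y \<longleftrightarrow> (\<exists>b\<in>Basis. y = x + \<delta> *\<^sub>R b \<or> y = x - \<delta> *\<^sub>R b)"

definition dlaplacian :: "real \<Rightarrow> ('a::euclidean_space \<Rightarrow> real) \<Rightarrow> 'a \<Rightarrow> real" where
  "dlaplacian \<delta> u x =
     ((\<Sum>b\<in>Basis. u (x + \<delta> *\<^sub>R b) + u (x - \<delta> *\<^sub>R b)) - 2 * real DIM('a) * u x) / \<delta>\<^sup>2"

definition dharmonic_on :: "real \<Rightarrow> ('a::euclidean_space \<Rightarrow> real) \<Rightarrow> 'a set \<Rightarrow> bool" where
  "dharmonic_on \<delta> u S \<longleftrightarrow> (\<forall>x\<in>S. dlaplacian \<delta> u x = 0)"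

definition dinterior :: "'a::euclidean_space set \<Rightarrow> real \<Rightarrow> 'a set" where
  "dinterior \<Omega> \<delta> = \<Omega> \<inter> grid \<delta>"

definition dboundary :: "'a::euclidean_space set \<Rightarrow> real \<Rightarrow> 'a set" where
  "dboundary \<Omega> \<delta> = {x \<in> grid \<delta> - dinterior \<Omega> \<delta>. \<exists>y\<in>dinterior \<Omega> \<delta>. neighbors \<delta> x y}"

definition dclosure :: "'a::euclidean_space set \<Rightarrow> real \<Rightarrow> 'a set" where
  "dclosure \<Omega> \<delta> = dinterior \<Omega> \<delta> \<union> dboundary \<Omega> \<delta>"

definition dconnected :: "real \<Rightarrow> 'a::euclidean_space set \<Rightarrow> bool" where
  "dconnected \<delta> S \<longleftrightarrow>
     (\<forall>x\<in>S. \<forall>y\<in>S. rtranclp (\<lambda>u v. u \<in> S \<and> v \<in> S \<and> neighbors \<delta> u v) x y)"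

definition admissible_threshold :: "'a::euclidean_space set \<Rightarrow> real \<Rightarrow> bool" where
  "admissible_threshold \<Omega> \<delta>\<^sub>0 \<longleftrightarrow> \<delta>\<^sub>0 > 0 \<and>
     (\<forall>\<delta>. 0 < \<delta> \<and> \<delta> < \<delta>\<^sub>0 \<longrightarrow> dinterior \<Omega> \<delta> \<noteq> {} \<and> dconnected \<delta> (dinterior \<Omega> \<delta>))"

definition dirichlet_eigenvalue :: "'a::euclidean_space set \<Rightarrow> real \<Rightarrow> real \<Rightarrow> bool" where
  "dirichlet_eigenvalue \<Omega> \<delta> \<mu> \<longleftrightarrow>
     (\<exists>f. (\<exists>x\<in>dinterior \<Omega> \<delta>. f x \<noteq> 0) \<and>
          (\<forall>x\<in>dboundary \<Omega> \<delta>. f x = 0) \<and>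
          (\<forall>x\<in>dinterior \<Omega> \<delta>. - dlaplacian \<delta> f x = \<mu> * f x))"

text \<open>
  For bounded \<open>\<Omega>\<close> and \<open>\<delta> > 0\<close> with nonempty \<open>dinterior \<Omega> \<delta>\<close>, the Dirichlet problem is the
  eigenvalue problem of a real symmetric matrix, so there are eigenvalues, finitely many of them,
  and the least one below exists.
\<close>

definition first_eigenvalue :: "'a::euclidean_space set \<Rightarrow> real \<Rightarrow> real" where
  "first_eigenvalue \<Omega> \<delta> = (LEAST \<mu>. dirichlet_eigenvalue \<Omega> \<delta> \<mu>)"

definition first_rate :: "'a::euclidean_space set \<Rightarrow> real \<Rightarrow> real" where
  "first_rate \<Omega> \<delta> = arcosh (1 + \<delta>\<^sup>2 * first_eigenvalue \<Omega> \<delta> / 2) / \<delta>"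

text \<open>
  Near each boundary point, \<open>\<Omega>\<close> lies strictly above the graph of a Lipschitz function over the
  hyperplane orthogonal to some unit vector \<open>e\<close>; \<open>x - (x \<bullet> e) *\<^sub>R e\<close> is the projection onto it.
\<close>

definition lipschitz_boundary :: "'a::euclidean_space set \<Rightarrow> bool" where
  "lipschitz_boundary \<Omega> \<longleftrightarrow>
     (\<forall>p\<in>frontier \<Omega>. \<exists>e r L g. norm e = 1 \<and> r > 0 \<and> L-lipschitz_on {y. y \<bullet> e = 0} g \<and>
        \<Omega> \<inter> ball p r = {x \<in> ball p r. x \<bullet> e > g (x - (x \<bullet> e) *\<^sub>R e)})"

end

theory Submission
  imports Defs
begin

text \<open>
  Let \<open>\<lambda>\<close> be the first Dirichlet eigenvalue of the lattice domain \<open>D = \<Omega> \<inter> (\<delta>\<int>)\<^sup>n\<close> and \<open>a\<close> the first rate, so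
  that \<open>cosh (a \<delta>) = 1 + \<delta>\<^sup>2 \<lambda> / 2\<close>.  If \<open>h\<close> is harmonic and \<open>h \<le> F\<close> on the lateral boundary, the positive part
  \<open>w\<close> of \<open>h - F\<close>, extended by zero off \<open>D\<close>, is nonnegative and subharmonic.  Let \<open>E(t)\<close> be its Euclidean
  norm over the slice at height \<open>t\<close>.  Since \<open>\<lambda>\<close> is the minimum of the Rayleigh quotient, pairing the
  subharmonicity with \<open>w\<close> gives \<open>E(t + \<delta>) + E(t - \<delta>) \<ge> 2 cosh (a \<delta>) E(t)\<close> (\<open>slice_norm_growth\<close>), and
  comparison with \<open>cosh (a t)\<close> yields \<open>E(t) \<le> E\<^sub>0 cosh (a t) / cosh (a T)\<close> for \<open>\<bar>t\<bar> \<le> T\<close> when \<open>E(\<plusminus>T) \<le> E\<^sub>0\<close>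
  (\<open>slice_norm_le_cosh\<close>).  In the infinite cylinder the growth hypothesis then forces \<open>E = 0\<close>, which is
  the Phragmen-Lindelof principle.

  For the finite cylinder this norm estimate has to be turned into a pointwise one with a constant
  independent of \<open>\<delta>\<close>.  Put \<open>\<Omega>\<close> into a cube of half-width \<open>L = \<delta> K\<close>.  As \<open>w\<close> is subharmonic on the whole
  cylinder over the cube and vanishes on its lateral boundary, it is dominated for \<open>\<bar>t\<bar> \<le> 1\<close> by the
  harmonic function with end data \<open>w(\<cdot>, 1) + w(\<cdot>, -1)\<close>.  This function is an explicit sine series, and the
  damping factors \<open>1 / cosh\<close> of its modes have a sum bounded in terms of \<open>L\<close> and \<open>n\<close>.  Therefore \<open>w(x, 0)\<close>
  is at most a constant times \<open>K\<^sup>-\<^sup>n\<close> times the sum of the end data (\<open>subharmonic_middle_bound\<close>), and by the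
  Cauchy-Schwarz inequality that sum is at most the square root of the number of lattice points times
  \<open>E(1) + E(-1)\<close>.  The remaining factor \<open>cosh a\<close> is bounded because \<open>a\<^sup>2 \<le> \<lambda>\<close>, and \<open>\<lambda>\<close> is bounded through a
  test function on a cube inside \<open>\<Omega>\<close> (\<open>first_eigenvalue_le_cube\<close>).  Upper bounds for \<open>h\<close> and \<open>- h\<close>
  together bound \<open>\<bar>h\<bar>\<close>.
\<close>

section \<open>The discrete Laplacian and its maximum principle\<close>

lemma dlaplacian_eq_sum_second_differences:
  fixes u :: "'a::euclidean_space \<Rightarrow> real"
  shows "dlaplacian \<delta> u x = (\<Sum>b\<in>Basis. u (x + \<delta> *\<^sub>R b) + u (x - \<delta> *\<^sub>R b) - 2 * u x) / \<delta>\<^sup>2"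
  by (simp add: dlaplacian_def sum_subtractf)

lemma dlaplacian_diff: "dlaplacian \<delta> (\<lambda>x. u x - v x) x = dlaplacian \<delta> u x - dlaplacian \<delta> v x"
  by (simp add: dlaplacian_eq_sum_second_differences sum_subtractf[symmetric] diff_divide_distrib[symmetric]
      algebra_simps)

lemma dlaplacian_add: "dlaplacian \<delta> (\<lambda>x. u x + v x) x = dlaplacian \<delta> u x + dlaplacian \<delta> v x"
  by (simp add: dlaplacian_eq_sum_second_differences sum.distrib[symmetric] add_divide_distrib[symmetric]
      algebra_simps)

lemma dlaplacian_cmult: "dlaplacian \<delta> (\<lambda>x. c * u x) x = c * dlaplacian \<delta> u x"
  by (simp add: dlaplacian_eq_sum_second_differences sum_distrib_left algebra_simps)

lemma dlaplacian_uminus: "dlaplacian \<delta> (\<lambda>x. - u x) x = - dlaplacian \<delta> u x"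
  using dlaplacian_cmult[of \<delta> "-1" u x] by simp

lemma dlaplacian_const: "dlaplacian \<delta> (\<lambda>x. c) x = 0"
  by (simp add: dlaplacian_eq_sum_second_differences)

lemma dlaplacian_sum:
  "finite I \<Longrightarrow> dlaplacian \<delta> (\<lambda>x. \<Sum>i\<in>I. u i x) x = (\<Sum>i\<in>I. dlaplacian \<delta> (u i) x)"
  by (induction I rule: finite_induct) (simp_all add: dlaplacian_const dlaplacian_add)

lemma dlaplacian_mono:
  assumes "u x = v x"
    and "\<And>b. b \<in> Basis \<Longrightarrow> v (x + \<delta> *\<^sub>R b) \<le> u (x + \<delta> *\<^sub>R b)"
    and "\<And>b. b \<in> Basis \<Longrightarrow> v (x - \<delta> *\<^sub>R b) \<le> u (x - \<delta> *\<^sub>R b)"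
  shows "dlaplacian \<delta> v x \<le> dlaplacian \<delta> u x"
  unfolding dlaplacian_eq_sum_second_differences
  by (intro divide_right_mono sum_mono) (use assms in \<open>auto simp: add_mono\<close>)

lemma dlaplacian_real:
  "dlaplacian \<delta> u (t::real) = (u (t + \<delta>) + u (t - \<delta>) - 2 * u t) / \<delta>\<^sup>2"
  by (simp add: dlaplacian_eq_sum_second_differences)

lemma dlaplacian_prod:
  fixes u :: "'a::euclidean_space \<times> 'b::euclidean_space \<Rightarrow> real"
  shows "dlaplacian \<delta> u (x, t) = dlaplacian \<delta> (\<lambda>y. u (y, t)) x + dlaplacian \<delta> (\<lambda>s. u (x, s)) t"
proof -
  have split: "sum f Basis = (\<Sum>b\<in>Basis. f (b, 0)) + (\<Sum>b\<in>Basis. f (0, b))"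
    for f :: "'a \<times> 'b \<Rightarrow> real"
    unfolding Basis_prod_def
    by (subst sum.union_disjoint) (auto simp: sum.reindex inj_on_def)
  show ?thesis
    unfolding dlaplacian_eq_sum_second_differences split by (simp add: add_divide_distrib)
qed

lemma neighbors_prod_real_iff:
  fixes x y :: "'a::euclidean_space" and s t :: real
  shows "neighbors \<delta> (x, t) (y, s) \<longleftrightarrow> (neighbors \<delta> x y \<and> s = t) \<or> (y = x \<and> (s = t + \<delta> \<or> s = t - \<delta>))"
  by (auto simp: neighbors_def Basis_prod_def)

lemma neighbors_real_iff: "neighbors \<delta> (t::real) s \<longleftrightarrow> s = t + \<delta> \<or> s = t - \<delta>"
  by (simp add: neighbors_def)

lemma neighbors_plus: "b \<in> Basis \<Longrightarrow> neighbors \<delta> x (x + \<delta> *\<^sub>R b)"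
  and neighbors_minus: "b \<in> Basis \<Longrightarrow> neighbors \<delta> x (x - \<delta> *\<^sub>R b)"
  by (auto simp: neighbors_def)

text \<open>
  Subharmonicity is required only where \<open>u\<close> is positive.  Hence the principle also applies to
  \<open>u\<close> on the line with \<open>u(t + \<delta>) + u(t - \<delta>) \<ge> 2 c u(t)\<close> and \<open>c \<ge> 1\<close>, such as differences of slice norms
  and multiples of \<open>cosh (a t)\<close>.
\<close>

lemma discrete_maximum_principle:
  fixes u :: "'a::euclidean_space \<Rightarrow> real"
  assumes "\<delta> > 0" and "finite S"
    and subharmonic: "\<And>x. x \<in> S \<Longrightarrow> u x > 0 \<Longrightarrow> dlaplacian \<delta> u x \<ge> 0"
    and boundary: "\<And>x y. x \<in> S \<Longrightarrow> neighbors \<delta> x y \<Longrightarrow> y \<notin> S \<Longrightarrow> u y \<le> 0"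
    and "x \<in> S"
  shows "u x \<le> 0"
proof (rule ccontr)
  assume "\<not> u x \<le> 0"
  define m where "m = Max (u ` S)"
  have le_m: "u y \<le> m" if "y \<in> S" for y
    using that \<open>finite S\<close> by (simp add: m_def)
  have "m > 0"
    using le_m[OF \<open>x \<in> S\<close>] \<open>\<not> u x \<le> 0\<close> by simp
  define T where "T = {y \<in> S. u y = m}"
  have "m \<in> u ` S"
    unfolding m_def using \<open>finite S\<close> \<open>x \<in> S\<close> by (intro Max_in) auto
  then have "T \<noteq> {}" by (auto simp: T_def)
  have "finite T" using \<open>finite S\<close> by (simp add: T_def)
  obtain b :: 'a where b: "b \<in> Basis" using nonempty_Basis by blast
  \<comment> \<open>among the points where the maximum is attained, take one that is extreme in direction \<open>b\<close>\<close>
  obtain y where "y \<in> T" and y_max: "\<And>z. z \<in> T \<Longrightarrow> z \<bullet> b \<le> y \<bullet> b"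
    using \<open>finite T\<close> \<open>T \<noteq> {}\<close> obtains_MAX[of T "\<lambda>z. z \<bullet> b"]
    by (metis (mono_tags, lifting) Max_ge finite_imageI imageI)
  have "y \<in> S" "u y = m" using \<open>y \<in> T\<close> by (auto simp: T_def)
  have nb: "u z \<le> m" if "neighbors \<delta> y z" for z
    using boundary[OF \<open>y \<in> S\<close> that] le_m[of z] \<open>m > 0\<close> by fastforce
  have terms: "u (y + \<delta> *\<^sub>R c) + u (y - \<delta> *\<^sub>R c) - 2 * u y \<le> 0" if "c \<in> Basis" for c
    using nb[OF neighbors_plus[OF that]] nb[OF neighbors_minus[OF that]] \<open>u y = m\<close> by simp
  have "0 \<le> dlaplacian \<delta> u y"
    using subharmonic[OF \<open>y \<in> S\<close>] \<open>u y = m\<close> \<open>m > 0\<close> by simp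
  then have "0 \<le> (\<Sum>c\<in>Basis. u (y + \<delta> *\<^sub>R c) + u (y - \<delta> *\<^sub>R c) - 2 * u y)"
    using \<open>\<delta> > 0\<close> by (simp add: dlaplacian_eq_sum_second_differences zero_le_divide_iff)
  also have "\<dots> = (u (y + \<delta> *\<^sub>R b) + u (y - \<delta> *\<^sub>R b) - 2 * u y) +
      (\<Sum>c\<in>Basis - {b}. u (y + \<delta> *\<^sub>R c) + u (y - \<delta> *\<^sub>R c) - 2 * u y)"
    by (rule sum.remove) (use b in auto)
  also have "(\<Sum>c\<in>Basis - {b}. u (y + \<delta> *\<^sub>R c) + u (y - \<delta> *\<^sub>R c) - 2 * u y) \<le> 0"
    by (rule sum_nonpos, rule terms) auto
  finally have "0 \<le> u (y + \<delta> *\<^sub>R b) + u (y - \<delta> *\<^sub>R b) - 2 * u y" by simp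
  then have "u (y + \<delta> *\<^sub>R b) = m"
    using nb[OF neighbors_plus[OF b]] nb[OF neighbors_minus[OF b]] \<open>u y = m\<close> by simp
  moreover have "y + \<delta> *\<^sub>R b \<in> S"
  proof (rule ccontr)
    assume "y + \<delta> *\<^sub>R b \<notin> S"
    then have "u (y + \<delta> *\<^sub>R b) \<le> 0"
      using boundary[OF \<open>y \<in> S\<close> neighbors_plus[OF b]] by blast
    then show False using \<open>u (y + \<delta> *\<^sub>R b) = m\<close> \<open>m > 0\<close> by simp
  qed
  ultimately have "y + \<delta> *\<^sub>R b \<in> T" by (simp add: T_def)
  from y_max[OF this] show False
    using b \<open>\<delta> > 0\<close> by (simp add: inner_simps)
qed

section \<open>Lattice points\<close>

lemma grid_coordinate:
  assumes "x \<in> grid \<delta>" and "b \<in> Basis"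
  obtains k :: int where "x \<bullet> b = \<delta> * of_int k"
  using assms unfolding grid_def by blast

lemma grid_plus: "x \<in> grid \<delta> \<Longrightarrow> b \<in> Basis \<Longrightarrow> x + \<delta> *\<^sub>R b \<in> grid \<delta>"
  unfolding grid_def
proof (safe)
  fix c :: 'a assume x: "\<forall>b\<in>Basis. \<exists>k::int. x \<bullet> b = \<delta> * of_int k" and "b \<in> Basis" and "c \<in> Basis"
  then obtain k :: int where "x \<bullet> c = \<delta> * of_int k" by blast
  then have "(x + \<delta> *\<^sub>R b) \<bullet> c = \<delta> * of_int (k + (if b = c then 1 else 0))"
    using \<open>b \<in> Basis\<close> \<open>c \<in> Basis\<close> by (auto simp: inner_simps inner_Basis algebra_simps)
  then show "\<exists>k::int. (x + \<delta> *\<^sub>R b) \<bullet> c = \<delta> * of_int k" by blast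
qed

lemma grid_minus: "x \<in> grid \<delta> \<Longrightarrow> b \<in> Basis \<Longrightarrow> x - \<delta> *\<^sub>R b \<in> grid \<delta>"
  unfolding grid_def
proof (safe)
  fix c :: 'a assume x: "\<forall>b\<in>Basis. \<exists>k::int. x \<bullet> b = \<delta> * of_int k" and "b \<in> Basis" and "c \<in> Basis"
  then obtain k :: int where "x \<bullet> c = \<delta> * of_int k" by blast
  then have "(x - \<delta> *\<^sub>R b) \<bullet> c = \<delta> * of_int (k - (if b = c then 1 else 0))"
    using \<open>b \<in> Basis\<close> \<open>c \<in> Basis\<close> by (auto simp: inner_simps inner_Basis algebra_simps)
  then show "\<exists>k::int. (x - \<delta> *\<^sub>R b) \<bullet> c = \<delta> * of_int k" by blast
qed

lemma grid_neighbors: "x \<in> grid \<delta> \<Longrightarrow> neighbors \<delta> x y \<Longrightarrow> y \<in> grid \<delta>"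
  using grid_plus grid_minus by (auto simp: neighbors_def)

lemma grid_real_iff: "(t::real) \<in> grid \<delta> \<longleftrightarrow> (\<exists>k::int. t = \<delta> * of_int k)"
  by (simp add: grid_def)

lemma grid_real_plus: "(t::real) \<in> grid \<delta> \<Longrightarrow> t + \<delta> \<in> grid \<delta>"
  and grid_real_minus: "(t::real) \<in> grid \<delta> \<Longrightarrow> t - \<delta> \<in> grid \<delta>"
  using grid_plus[of t \<delta> 1] grid_minus[of t \<delta> 1] by auto

lemma grid_real_uminus: "(t::real) \<in> grid \<delta> \<Longrightarrow> - t \<in> grid \<delta>"
  unfolding grid_real_iff by (metis mult_minus_right of_int_minus)

lemma neighbors_sym: "neighbors \<delta> x y \<longleftrightarrow> neighbors \<delta> y x"
  by (auto simp: neighbors_def algebra_simps)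

lemma dboundary_neighbor:
  "x \<in> dinterior \<Omega> \<delta> \<Longrightarrow> neighbors \<delta> x y \<Longrightarrow> y \<notin> dinterior \<Omega> \<delta> \<Longrightarrow> y \<in> dboundary \<Omega> \<delta>"
  unfolding dboundary_def using grid_neighbors neighbors_sym by (fastforce simp: dinterior_def)

text \<open>The interior lattice points of the cube of half-width \<open>\<delta> K\<close>.\<close>

definition cube_points :: "real \<Rightarrow> nat \<Rightarrow> 'a::euclidean_space set" where
  "cube_points \<delta> K = {x \<in> grid \<delta>. \<forall>b\<in>Basis. \<bar>x \<bullet> b\<bar> < \<delta> * real K}"

lemma
  assumes "\<delta> > 0"
  shows finite_cube_points: "finite (cube_points \<delta> K :: 'a::euclidean_space set)"
    and card_cube_points: "card (cube_points \<delta> K :: 'a set) \<le> (2 * K) ^ DIM('a)"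
proof -
  let ?g = "\<lambda>x::'a. \<lambda>b\<in>Basis. \<lfloor>x \<bullet> b / \<delta>\<rfloor>"
  let ?P = "(\<Pi>\<^sub>E b\<in>(Basis::'a set). {- int K..<int K})"
  have inj: "inj_on ?g (cube_points \<delta> K)"
  proof (rule inj_onI)
    fix x y :: 'a
    assume x: "x \<in> cube_points \<delta> K" and y: "y \<in> cube_points \<delta> K" and eq: "?g x = ?g y"
    show "x = y"
    proof (rule euclidean_eqI)
      fix b :: 'a assume b: "b \<in> Basis"
      have "x \<in> grid \<delta>" "y \<in> grid \<delta>" using x y by (simp_all add: cube_points_def)
      then obtain k l :: int where k: "x \<bullet> b = \<delta> * k" and l: "y \<bullet> b = \<delta> * l"
        using b by (meson grid_coordinate)
      have "\<lfloor>x \<bullet> b / \<delta>\<rfloor> = \<lfloor>y \<bullet> b / \<delta>\<rfloor>"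
        using fun_cong[OF eq, of b] b by simp
      then show "x \<bullet> b = y \<bullet> b" using k l \<open>\<delta> > 0\<close> by simp
    qed
  qed
  have sub: "?g ` cube_points \<delta> K \<subseteq> ?P"
  proof (rule image_subsetI)
    fix x :: 'a assume x: "x \<in> cube_points \<delta> K"
    have "\<lfloor>x \<bullet> b / \<delta>\<rfloor> \<in> {- int K..<int K}" if b: "b \<in> Basis" for b
    proof -
      have "x \<in> grid \<delta>" using x by (simp add: cube_points_def)
      then obtain k :: int where k: "x \<bullet> b = \<delta> * k"
        using b by (meson grid_coordinate)
      have "\<bar>x \<bullet> b\<bar> < \<delta> * real K" using x b by (auto simp: cube_points_def)
      then have "\<bar>real_of_int k\<bar> < real K" using \<open>\<delta> > 0\<close> by (simp add: k abs_mult)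
      then show ?thesis using \<open>\<delta> > 0\<close> by (simp add: k) linarith
    qed
    then show "?g x \<in> ?P" by auto
  qed
  have fin: "finite ?P" by (intro finite_PiE) auto
  show "finite (cube_points \<delta> K :: 'a set)"
    using inj sub fin by (meson finite_imageD finite_subset)
  have card_ints: "card {- int K..<int K} = 2 * K" by simp
  have "card ?P = (2 * K) ^ DIM('a)"
    using card_ints by (simp add: card_PiE)
  then show "card (cube_points \<delta> K :: 'a set) \<le> (2 * K) ^ DIM('a)"
    using card_inj_on_le[OF inj sub fin] by simp
qed

lemma dinterior_subset_cube_points:
  assumes "\<And>x b. x \<in> \<Omega> \<Longrightarrow> b \<in> Basis \<Longrightarrow> \<bar>x \<bullet> b\<bar> < \<delta> * real K"
  shows "dinterior \<Omega> \<delta> \<subseteq> cube_points \<delta> K"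
  using assms by (auto simp: dinterior_def cube_points_def)

lemma finite_dinterior:
  fixes \<Omega> :: "'a::euclidean_space set"
  assumes "bounded \<Omega>" and "\<delta> > 0"
  shows "finite (dinterior \<Omega> \<delta>)"
proof -
  obtain R where R: "\<And>x. x \<in> \<Omega> \<Longrightarrow> norm x \<le> R"
    using \<open>bounded \<Omega>\<close> by (auto simp: bounded_iff)
  obtain K :: nat where "R / \<delta> < real K" using reals_Archimedean2 by blast
  then have K: "R < \<delta> * real K" using \<open>\<delta> > 0\<close> by (simp add: field_simps)
  have "dinterior \<Omega> \<delta> \<subseteq> cube_points \<delta> K"
    by (intro dinterior_subset_cube_points) (use R K Basis_le_norm in \<open>fastforce intro: order_le_less_trans\<close>)
  then show ?thesis using finite_cube_points[OF \<open>\<delta> > 0\<close>] finite_subset by blast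
qed

lemma finite_grid_real:
  assumes "\<delta> > 0" shows "finite {t \<in> grid \<delta>. \<bar>t::real\<bar> \<le> T}"
proof -
  have "{t \<in> grid \<delta>. \<bar>t::real\<bar> \<le> T} = dinterior {-T..T} \<delta>"
    by (auto simp: dinterior_def)
  then show ?thesis using finite_dinterior[of "{-T..T}" \<delta>] assms by simp
qed

lemma finite_dboundary:
  fixes \<Omega> :: "'a::euclidean_space set"
  assumes "bounded \<Omega>" and "\<delta> > 0"
  shows "finite (dboundary \<Omega> \<delta>)"
proof (rule finite_subset)
  let ?D = "dinterior \<Omega> \<delta>"
  show "dboundary \<Omega> \<delta> \<subseteq> (\<lambda>(y, b). y + \<delta> *\<^sub>R b) ` (?D \<times> Basis) \<union> (\<lambda>(y, b). y - \<delta> *\<^sub>R b) ` (?D \<times> Basis)"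
  proof
    fix x :: 'a assume "x \<in> dboundary \<Omega> \<delta>"
    then obtain y where "y \<in> ?D" "neighbors \<delta> y x"
      unfolding dboundary_def using neighbors_sym[of \<delta> x] by blast
    then obtain b where "b \<in> Basis" "x = y + \<delta> *\<^sub>R b \<or> x = y - \<delta> *\<^sub>R b"
      unfolding neighbors_def by blast
    with \<open>y \<in> ?D\<close> show "x \<in> (\<lambda>(y, b). y + \<delta> *\<^sub>R b) ` (?D \<times> Basis) \<union> (\<lambda>(y, b). y - \<delta> *\<^sub>R b) ` (?D \<times> Basis)"
      by (elim disjE) (auto intro!: image_eqI[of _ _ "(y, b)"])
  qed
qed (use finite_dinterior[OF assms] in auto)

lemma dboundary_nonempty:
  fixes \<Omega> :: "'a::euclidean_space set"
  assumes "finite (dinterior \<Omega> \<delta>)" and "dinterior \<Omega> \<delta> \<noteq> {}" and "\<delta> > 0"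
  shows "dboundary \<Omega> \<delta> \<noteq> {}"
proof -
  obtain b :: 'a where b: "b \<in> Basis" using nonempty_Basis by blast
  obtain y where y: "y \<in> dinterior \<Omega> \<delta>" and y_max: "\<And>z. z \<in> dinterior \<Omega> \<delta> \<Longrightarrow> z \<bullet> b \<le> y \<bullet> b"
    using assms(1,2) obtains_MAX[of "dinterior \<Omega> \<delta>" "\<lambda>z. z \<bullet> b"]
    by (metis (mono_tags, lifting) Max_ge finite_imageI imageI)
  have "y + \<delta> *\<^sub>R b \<notin> dinterior \<Omega> \<delta>"
    using y_max[of "y + \<delta> *\<^sub>R b"] b \<open>\<delta> > 0\<close> by (auto simp: inner_simps)
  then have "y + \<delta> *\<^sub>R b \<in> dboundary \<Omega> \<delta>"
    by (intro dboundary_neighbor[OF y]) (use b in \<open>auto simp: neighbors_def\<close>)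
  then show ?thesis by blast
qed


section \<open>The first Dirichlet eigenvalue as a minimum of the Rayleigh quotient\<close>

text \<open>
  The pairing of \<open>f\<close> with \<open>- \<Delta> g\<close> over the finite set \<open>D\<close>, not normalised by \<open>\<delta>\<close>.  It is symmetric and
  positive semidefinite on the functions vanishing off \<open>D\<close>.
\<close>

definition dirichlet_form :: "real \<Rightarrow> 'a::euclidean_space set \<Rightarrow> ('a \<Rightarrow> real) \<Rightarrow> ('a \<Rightarrow> real) \<Rightarrow> real" where
  "dirichlet_form \<delta> D f g = (\<Sum>x\<in>D. f x * - dlaplacian \<delta> g x)"

lemma dirichlet_form_add_left:
    "dirichlet_form \<delta> D (\<lambda>x. f x + h x) g = dirichlet_form \<delta> D f g + dirichlet_form \<delta> D h g"
  and dirichlet_form_add_right: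
    "dirichlet_form \<delta> D f (\<lambda>x. g x + h x) = dirichlet_form \<delta> D f g + dirichlet_form \<delta> D f h"
  and dirichlet_form_cmult_left: "dirichlet_form \<delta> D (\<lambda>x. c * f x) g = c * dirichlet_form \<delta> D f g"
  and dirichlet_form_cmult_right: "dirichlet_form \<delta> D f (\<lambda>x. c * g x) = c * dirichlet_form \<delta> D f g"
  by (simp_all add: dirichlet_form_def dlaplacian_add dlaplacian_cmult algebra_simps sum_distrib_left
      sum.distrib[symmetric] sum_negf[symmetric])

lemma sum_shift:
  fixes f g :: "'a::ab_group_add \<Rightarrow> real"
  assumes "finite D" and "\<And>x. x \<notin> D \<Longrightarrow> f x = 0" and "\<And>x. x \<notin> D \<Longrightarrow> g x = 0"
  shows "(\<Sum>x\<in>D. f x * g (x + v)) = (\<Sum>x\<in>D. f (x - v) * g x)"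
proof -
  have "(\<Sum>x\<in>D. f x * g (x + v)) = (\<Sum>x\<in>{x\<in>D. x + v \<in> D}. f x * g (x + v))"
    by (rule sum.mono_neutral_right) (use assms in auto)
  also have "\<dots> = (\<Sum>x\<in>{x\<in>D. x - v \<in> D}. f (x - v) * g x)"
    by (rule sum.reindex_bij_witness[of _ "\<lambda>y. y - v" "\<lambda>x. x + v"]) auto
  also have "\<dots> = (\<Sum>x\<in>D. f (x - v) * g x)"
    by (rule sum.mono_neutral_left) (use assms in auto)
  finally show ?thesis .
qed

lemma sum_shift_square_le:
  fixes g :: "'a::ab_group_add \<Rightarrow> real"
  assumes "finite D" and "\<And>x. x \<notin> D \<Longrightarrow> g x = 0"
  shows "(\<Sum>x\<in>D. (g (x + v))\<^sup>2) \<le> (\<Sum>x\<in>D. (g x)\<^sup>2)"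
proof -
  have "(\<Sum>x\<in>D. (g (x + v))\<^sup>2) = (\<Sum>x\<in>{x\<in>D. x + v \<in> D}. (g (x + v))\<^sup>2)"
    by (rule sum.mono_neutral_right) (use assms in auto)
  also have "\<dots> = (\<Sum>x\<in>{x\<in>D. x - v \<in> D}. (g x)\<^sup>2)"
    by (rule sum.reindex_bij_witness[of _ "\<lambda>y. y - v" "\<lambda>x. x + v"]) auto
  also have "\<dots> \<le> (\<Sum>x\<in>D. (g x)\<^sup>2)"
    by (rule sum_mono2) (use assms in auto)
  finally show ?thesis .
qed

lemma dirichlet_form_eq:
  "dirichlet_form \<delta> D f g =
     (\<Sum>b\<in>Basis. 2 * (\<Sum>x\<in>D. f x * g x) - (\<Sum>x\<in>D. f x * g (x + \<delta> *\<^sub>R b)) - (\<Sum>x\<in>D. f x * g (x - \<delta> *\<^sub>R b)))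
       / \<delta>\<^sup>2"
proof -
  have "f x * - dlaplacian \<delta> g x =
      (\<Sum>b\<in>Basis. 2 * (f x * g x) - f x * g (x + \<delta> *\<^sub>R b) - f x * g (x - \<delta> *\<^sub>R b)) / \<delta>\<^sup>2" for x
    by (simp add: dlaplacian_def sum_subtractf sum.distrib sum_distrib_left[symmetric]
        algebra_simps diff_divide_distrib add_divide_distrib)
  then have "dirichlet_form \<delta> D f g =
      (\<Sum>x\<in>D. \<Sum>b\<in>Basis. 2 * (f x * g x) - f x * g (x + \<delta> *\<^sub>R b) - f x * g (x - \<delta> *\<^sub>R b)) / \<delta>\<^sup>2"
    by (simp only: dirichlet_form_def sum_divide_distrib)
  also have "(\<Sum>x\<in>D. \<Sum>b\<in>Basis. 2 * (f x * g x) - f x * g (x + \<delta> *\<^sub>R b) - f x * g (x - \<delta> *\<^sub>R b)) =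
      (\<Sum>b\<in>Basis. \<Sum>x\<in>D. 2 * (f x * g x) - f x * g (x + \<delta> *\<^sub>R b) - f x * g (x - \<delta> *\<^sub>R b))"
    by (rule sum.swap)
  finally show ?thesis
    by (simp only: sum_subtractf sum_distrib_left)
qed

lemma dirichlet_form_sym:
  assumes "finite D" and "\<And>x. x \<notin> D \<Longrightarrow> f x = 0" and "\<And>x. x \<notin> D \<Longrightarrow> g x = 0"
  shows "dirichlet_form \<delta> D f g = dirichlet_form \<delta> D g f"
proof -
  have "(\<Sum>x\<in>D. f x * g (x + v)) = (\<Sum>x\<in>D. g x * f (x - v))" for v
    using sum_shift[of D f g v, OF assms] by (simp add: mult.commute)
  from this this[of "- v" for v]
  have "2 * (\<Sum>x\<in>D. f x * g x) - (\<Sum>x\<in>D. f x * g (x + v)) - (\<Sum>x\<in>D. f x * g (x - v)) =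
      2 * (\<Sum>x\<in>D. g x * f x) - (\<Sum>x\<in>D. g x * f (x + v)) - (\<Sum>x\<in>D. g x * f (x - v))" for v
    by (simp add: mult.commute)
  then show ?thesis
    unfolding dirichlet_form_eq by simp
qed

lemma abs_sum_shift_le:
  fixes f :: "'a::ab_group_add \<Rightarrow> real"
  assumes "finite D" and "\<And>x. x \<notin> D \<Longrightarrow> f x = 0"
  shows "\<bar>\<Sum>x\<in>D. f x * f (x + v)\<bar> \<le> (\<Sum>x\<in>D. (f x)\<^sup>2)"
proof -
  have amgm: "\<bar>a * b\<bar> \<le> (a\<^sup>2 + b\<^sup>2) / 2" for a b :: real
    using sum_squares_bound[of a b] sum_squares_bound[of a "- b"] by (simp add: abs_le_iff)
  have "\<bar>\<Sum>x\<in>D. f x * f (x + v)\<bar> \<le> (\<Sum>x\<in>D. \<bar>f x * f (x + v)\<bar>)" by (rule sum_abs)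
  also have "\<dots> \<le> (\<Sum>x\<in>D. ((f x)\<^sup>2 + (f (x + v))\<^sup>2) / 2)" by (intro sum_mono amgm)
  also have "\<dots> = ((\<Sum>x\<in>D. (f x)\<^sup>2) + (\<Sum>x\<in>D. (f (x + v))\<^sup>2)) / 2"
    by (simp add: sum.distrib sum_divide_distrib[symmetric])
  also have "\<dots> \<le> (\<Sum>x\<in>D. (f x)\<^sup>2)"
    using sum_shift_square_le[of D f v, OF assms] by simp
  finally show ?thesis .
qed

lemma
  fixes f :: "'a::euclidean_space \<Rightarrow> real"
  assumes "finite D" and "\<And>x. x \<notin> D \<Longrightarrow> f x = 0"
  shows dirichlet_form_nonneg: "dirichlet_form \<delta> D f f \<ge> 0"
    and dirichlet_form_le: "dirichlet_form \<delta> D f f \<le> 4 * real DIM('a) / \<delta>\<^sup>2 * (\<Sum>x\<in>D. (f x)\<^sup>2)"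
proof -
  let ?s = "\<Sum>x\<in>D. (f x)\<^sup>2"
  let ?q = "\<lambda>b::'a. 2 * (\<Sum>x\<in>D. f x * f x) - (\<Sum>x\<in>D. f x * f (x + \<delta> *\<^sub>R b)) - (\<Sum>x\<in>D. f x * f (x - \<delta> *\<^sub>R b))"
  have q: "0 \<le> ?q b \<and> ?q b \<le> 4 * ?s" for b
    using abs_sum_shift_le[of D f "\<delta> *\<^sub>R b", OF assms]
      abs_sum_shift_le[of D f "- (\<delta> *\<^sub>R b)", OF assms]
    by (simp add: power2_eq_square abs_le_iff)
  show "dirichlet_form \<delta> D f f \<ge> 0"
    unfolding dirichlet_form_eq using q by (intro divide_nonneg_nonneg sum_nonneg) auto
  have "(\<Sum>b\<in>Basis. ?q b) \<le> (\<Sum>b\<in>(Basis::'a set). 4 * ?s)"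
    using q by (intro sum_mono) auto
  then show "dirichlet_form \<delta> D f f \<le> 4 * real DIM('a) / \<delta>\<^sup>2 * ?s"
    unfolding dirichlet_form_eq by (auto intro!: divide_right_mono)
qed

lemma quadratic_nonneg_imp_linear_coefficient_zero:
  fixes p q :: real
  assumes "\<And>s. 2 * s * p + s\<^sup>2 * q \<ge> 0"
  shows "p = 0"
proof (rule ccontr)
  assume "p \<noteq> 0"
  define Q c where "Q = \<bar>q\<bar> + 1" and "c = - p / Q"
  have "Q > 0" "q < 2 * Q" by (auto simp: Q_def)
  then have "c \<noteq> 0" "p = - c * Q" using \<open>p \<noteq> 0\<close> by (auto simp: c_def)
  have "0 \<le> 2 * c * p + c\<^sup>2 * q" by (rule assms)
  also have "\<dots> = c\<^sup>2 * (q - 2 * Q)"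
    by (simp add: \<open>p = - c * Q\<close> power2_eq_square algebra_simps)
  also have "\<dots> < 0"
    using \<open>c \<noteq> 0\<close> \<open>q < 2 * Q\<close> by (simp add: mult_less_0_iff)
  finally show False by simp
qed

text \<open>The Rayleigh quotient attains its minimum, since the unit sphere of a finite-dimensional space is compact.\<close>

lemma Rayleigh_quotient_minimizer:
  fixes D :: "'a::euclidean_space set"
  assumes "finite D" and "D \<noteq> {}"
  obtains \<phi> where "\<And>x. x \<notin> D \<Longrightarrow> \<phi> x = 0" and "(\<Sum>x\<in>D. (\<phi> x)\<^sup>2) = 1"
    and "\<And>f. (\<And>x. x \<notin> D \<Longrightarrow> f x = 0) \<Longrightarrow>
      dirichlet_form \<delta> D \<phi> \<phi> * (\<Sum>x\<in>D. (f x)\<^sup>2) \<le> dirichlet_form \<delta> D f f"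
proof -
  let ?B = "PiE UNIV (\<lambda>x. if x \<in> D then {-1..1} else {0}) :: ('a \<Rightarrow> real) set"
  let ?S = "?B \<inter> {f. (\<Sum>x\<in>D. (f x)\<^sup>2) = 1}"
  have "compactin (product_topology (\<lambda>_. euclidean) UNIV) ?B"
    by (subst compactin_PiE) auto
  then have "compact ?B"
    by (simp add: euclidean_product_topology)
  moreover have "closed {f :: 'a \<Rightarrow> real. (\<Sum>x\<in>D. (f x)\<^sup>2) = 1}"
    by (intro closed_Collect_eq continuous_intros continuous_on_product_coordinates)
  ultimately have "compact ?S" by (rule compact_Int_closed)
  moreover have "?S \<noteq> {}"
  proof -
    obtain x0 where "x0 \<in> D" using \<open>D \<noteq> {}\<close> by blast
    let ?f = "\<lambda>x. if x = x0 then 1 else 0 :: real"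
    have "(\<Sum>x\<in>D. (?f x)\<^sup>2) = (\<Sum>x\<in>D. if x = x0 then 1 else 0)"
      by (intro sum.cong) auto
    then have "(\<Sum>x\<in>D. (?f x)\<^sup>2) = 1"
      using \<open>finite D\<close> \<open>x0 \<in> D\<close> by simp
    then have "?f \<in> ?S" using \<open>x0 \<in> D\<close> by auto
    then show ?thesis by blast
  qed
  moreover have "continuous_on UNIV (\<lambda>f :: 'a \<Rightarrow> real. dirichlet_form \<delta> D f f)"
    unfolding dirichlet_form_eq divide_inverse by (intro continuous_intros continuous_on_product_coordinates)
  then have "continuous_on ?S (\<lambda>f. dirichlet_form \<delta> D f f)"
    using continuous_on_subset by blast
  ultimately obtain \<phi> where \<phi>: "\<phi> \<in> ?S" and
    min: "\<And>f. f \<in> ?S \<Longrightarrow> dirichlet_form \<delta> D \<phi> \<phi> \<le> dirichlet_form \<delta> D f f"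
    using continuous_attains_inf[of ?S "\<lambda>f. dirichlet_form \<delta> D f f"] by blast
  show thesis
  proof (rule that[of \<phi>])
    show "\<phi> x = 0" if "x \<notin> D" for x
    proof -
      have "\<phi> x \<in> (if x \<in> D then {-1..1} else {0})" using \<phi> by blast
      then show ?thesis using that by simp
    qed
    show "(\<Sum>x\<in>D. (\<phi> x)\<^sup>2) = 1" using \<phi> by simp
  next
    fix f :: "'a \<Rightarrow> real" assume f: "\<And>x. x \<notin> D \<Longrightarrow> f x = 0"
    define s where "s = (\<Sum>x\<in>D. (f x)\<^sup>2)"
    show "dirichlet_form \<delta> D \<phi> \<phi> * (\<Sum>x\<in>D. (f x)\<^sup>2) \<le> dirichlet_form \<delta> D f f"
    proof (cases "s = 0")
      case True
      then show ?thesis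
        using dirichlet_form_nonneg[of D f \<delta>] \<open>finite D\<close> f unfolding s_def by auto
    next
      case False
      then have "s > 0" unfolding s_def by (simp add: sum_nonneg order_less_le)
      let ?g = "\<lambda>x. (1 / sqrt s) * f x"
      have sum_g: "(\<Sum>x\<in>D. (?g x)\<^sup>2) = 1"
        using \<open>s > 0\<close> by (simp add: power_mult_distrib power_divide sum_divide_distrib[symmetric] s_def[symmetric])
      have "?g \<in> ?B"
      proof -
        have g_le: "\<bar>?g x\<bar> \<le> 1" if "x \<in> D" for x
        proof -
          have "(?g x)\<^sup>2 \<le> (\<Sum>x\<in>D. (?g x)\<^sup>2)"
            by (rule member_le_sum) (use that \<open>finite D\<close> in auto)
          then show ?thesis unfolding sum_g by (simp only: abs_square_le_1)
        qed
        have "?g x \<in> (if x \<in> D then {-1..1} else {0})" for x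
          using g_le[of x] f[of x] by (cases "x \<in> D") (simp_all only: abs_le_iff, auto)
        then show ?thesis by blast
      qed
      with sum_g have "dirichlet_form \<delta> D \<phi> \<phi> \<le> dirichlet_form \<delta> D ?g ?g" by (intro min) simp
      also have "\<dots> = dirichlet_form \<delta> D f f / s"
        using \<open>s > 0\<close> by (simp only: dirichlet_form_cmult_left dirichlet_form_cmult_right) simp
      finally have "dirichlet_form \<delta> D \<phi> \<phi> * s \<le> dirichlet_form \<delta> D f f"
        using \<open>s > 0\<close> by (simp add: pos_le_divide_eq)
      then show ?thesis by (simp only: s_def)
    qed
  qed
qed

lemma
  fixes \<Omega> :: "'a::euclidean_space set"
  assumes fin: "finite (dinterior \<Omega> \<delta>)" and ne: "dinterior \<Omega> \<delta> \<noteq> {}"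
  shows first_eigenvalue_nonneg: "first_eigenvalue \<Omega> \<delta> \<ge> 0"
    and first_eigenvalue_Rayleigh: "\<And>f. (\<And>x. x \<notin> dinterior \<Omega> \<delta> \<Longrightarrow> f x = 0) \<Longrightarrow>
      first_eigenvalue \<Omega> \<delta> * (\<Sum>x\<in>dinterior \<Omega> \<delta>. (f x)\<^sup>2) \<le> dirichlet_form \<delta> (dinterior \<Omega> \<delta>) f f"
proof -
  define D where "D = dinterior \<Omega> \<delta>"
  have "finite D" "D \<noteq> {}" using assms by (auto simp: D_def)
  obtain \<phi> where \<phi>0: "\<And>x. x \<notin> D \<Longrightarrow> \<phi> x = 0" and \<phi>1: "(\<Sum>x\<in>D. (\<phi> x)\<^sup>2) = 1"
    and min: "\<And>f. (\<And>x. x \<notin> D \<Longrightarrow> f x = 0) \<Longrightarrow>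
      dirichlet_form \<delta> D \<phi> \<phi> * (\<Sum>x\<in>D. (f x)\<^sup>2) \<le> dirichlet_form \<delta> D f f"
    using Rayleigh_quotient_minimizer[OF \<open>finite D\<close> \<open>D \<noteq> {}\<close>, of \<delta>] by metis
  define \<mu> where "\<mu> = dirichlet_form \<delta> D \<phi> \<phi>"
  have eigen: "- dlaplacian \<delta> \<phi> x = \<mu> * \<phi> x" if "x \<in> D" for x
  proof -
    \<comment> \<open>the first variation of the Rayleigh quotient in the direction of the point mass at \<open>x\<close>\<close>
    define g where "g = (\<lambda>y. if y = x then 1 else 0 :: real)"
    have g0: "\<And>y. y \<notin> D \<Longrightarrow> g y = 0" using that by (auto simp: g_def)
    have g_sum: "(\<Sum>y\<in>D. g y * k y) = k x" for k
    proof -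
      have "(\<Sum>y\<in>D. g y * k y) = (\<Sum>y\<in>D. if y = x then k y else 0)"
        by (intro sum.cong) (auto simp: g_def)
      then show ?thesis using that \<open>finite D\<close> by simp
    qed
    have "2 * s * (- dlaplacian \<delta> \<phi> x - \<mu> * \<phi> x) + s\<^sup>2 * (dirichlet_form \<delta> D g g - \<mu>) \<ge> 0" for s
    proof -
      have "(\<Sum>y\<in>D. (\<phi> y + s * g y)\<^sup>2) = (\<Sum>y\<in>D. (\<phi> y)\<^sup>2) + 2 * s * (\<Sum>y\<in>D. g y * \<phi> y) + s\<^sup>2 * (\<Sum>y\<in>D. g y * g y)"
        unfolding sum_distrib_left sum.distrib[symmetric]
        by (intro sum.cong) (auto simp: power2_eq_square algebra_simps)
      also have "\<dots> = 1 + 2 * s * \<phi> x + s\<^sup>2"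
        unfolding g_sum \<phi>1 by (simp add: g_def)
      finally have norm_eq: "(\<Sum>y\<in>D. (\<phi> y + s * g y)\<^sup>2) = 1 + 2 * s * \<phi> x + s\<^sup>2" .
      have "dirichlet_form \<delta> D (\<lambda>y. \<phi> y + s * g y) (\<lambda>y. \<phi> y + s * g y)
          = \<mu> + s * dirichlet_form \<delta> D \<phi> g + s * dirichlet_form \<delta> D g \<phi> + s\<^sup>2 * dirichlet_form \<delta> D g g"
        unfolding dirichlet_form_add_left dirichlet_form_add_right
          dirichlet_form_cmult_left dirichlet_form_cmult_right \<mu>_def
        by (simp add: power2_eq_square algebra_simps)
      also have "dirichlet_form \<delta> D \<phi> g = dirichlet_form \<delta> D g \<phi>"
        using dirichlet_form_sym[OF \<open>finite D\<close> \<phi>0 g0] .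
      also have "dirichlet_form \<delta> D g \<phi> = - dlaplacian \<delta> \<phi> x"
        unfolding dirichlet_form_def by (rule g_sum)
      finally have form_eq: "dirichlet_form \<delta> D (\<lambda>y. \<phi> y + s * g y) (\<lambda>y. \<phi> y + s * g y)
          = \<mu> + 2 * s * (- dlaplacian \<delta> \<phi> x) + s\<^sup>2 * dirichlet_form \<delta> D g g" by simp
      have "\<mu> * (1 + 2 * s * \<phi> x + s\<^sup>2) \<le> \<mu> + 2 * s * (- dlaplacian \<delta> \<phi> x) + s\<^sup>2 * dirichlet_form \<delta> D g g"
        using min[of "\<lambda>y. \<phi> y + s * g y"] \<phi>0 g0 unfolding norm_eq form_eq \<mu>_def[symmetric] by simp
      then show ?thesis by (simp add: algebra_simps)
    qed
    from quadratic_nonneg_imp_linear_coefficient_zero[OF this] show ?thesis by simp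
  qed
  have "first_eigenvalue \<Omega> \<delta> = \<mu>"
    unfolding first_eigenvalue_def
  proof (rule Least_equality)
    have "\<exists>x\<in>D. \<phi> x \<noteq> 0"
    proof (rule ccontr)
      assume "\<not> (\<exists>x\<in>D. \<phi> x \<noteq> 0)"
      then have "(\<Sum>x\<in>D. (\<phi> x)\<^sup>2) = 0" by simp
      then show False using \<phi>1 by simp
    qed
    moreover have "\<forall>x\<in>dboundary \<Omega> \<delta>. \<phi> x = 0"
      using \<phi>0 by (auto simp: dboundary_def D_def)
    ultimately show "dirichlet_eigenvalue \<Omega> \<delta> \<mu>"
      using eigen unfolding dirichlet_eigenvalue_def D_def by blast
  next
    fix \<nu> assume "dirichlet_eigenvalue \<Omega> \<delta> \<nu>"
    then obtain f where f1: "\<exists>x\<in>D. f x \<noteq> 0" and f2: "\<And>x. x \<in> dboundary \<Omega> \<delta> \<Longrightarrow> f x = 0"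
      and f3: "\<And>x. x \<in> D \<Longrightarrow> - dlaplacian \<delta> f x = \<nu> * f x"
      unfolding dirichlet_eigenvalue_def D_def by blast
    \<comment> \<open>the values of \<open>f\<close> off the discrete closure are irrelevant and may be taken to vanish\<close>
    define g where "g = (\<lambda>x. if x \<in> D then f x else 0)"
    have g_nb: "g y = f y" if "x \<in> D" "neighbors \<delta> x y" for x y
      using dboundary_neighbor[of x \<Omega> \<delta> y] that f2 by (auto simp: g_def D_def)
    have "dlaplacian \<delta> g x = dlaplacian \<delta> f x" if "x \<in> D" for x
      using g_nb[OF that neighbors_plus] g_nb[OF that neighbors_minus] that
      by (simp add: dlaplacian_eq_sum_second_differences g_def)
    then have "dirichlet_form \<delta> D g g = (\<Sum>x\<in>D. \<nu> * (g x)\<^sup>2)"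
      unfolding dirichlet_form_def using f3 by (intro sum.cong) (auto simp: g_def power2_eq_square)
    then have "dirichlet_form \<delta> D g g = \<nu> * (\<Sum>x\<in>D. (g x)\<^sup>2)" by (simp add: sum_distrib_left)
    moreover have "\<mu> * (\<Sum>x\<in>D. (g x)\<^sup>2) \<le> dirichlet_form \<delta> D g g"
      unfolding \<mu>_def by (rule min) (simp add: g_def)
    moreover have "(\<Sum>x\<in>D. (g x)\<^sup>2) > 0"
    proof -
      obtain x where "x \<in> D" "f x \<noteq> 0" using f1 by blast
      then show ?thesis using \<open>finite D\<close> by (intro sum_pos2[of D x]) (auto simp: g_def)
    qed
    ultimately show "\<mu> \<le> \<nu>" by simp
  qed
  then have eq: "first_eigenvalue \<Omega> \<delta> = dirichlet_form \<delta> D \<phi> \<phi>" by (simp add: \<mu>_def)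
  show "first_eigenvalue \<Omega> \<delta> \<ge> 0"
    unfolding eq using \<open>finite D\<close> \<phi>0 by (rule dirichlet_form_nonneg)
  show "first_eigenvalue \<Omega> \<delta> * (\<Sum>x\<in>dinterior \<Omega> \<delta>. (f x)\<^sup>2) \<le> dirichlet_form \<delta> (dinterior \<Omega> \<delta>) f f"
    if "\<And>x. x \<notin> dinterior \<Omega> \<delta> \<Longrightarrow> f x = 0" for f
    using min[of f] that unfolding eq D_def by blast
qed


section \<open>Exponential convexity of the slice norms\<close>

text \<open>
  A lattice step that leaves the open interval \<open>(- T, T)\<close> with \<open>T\<close> in the lattice lands on an end point.
\<close>

lemma grid_exit:
  fixes s t T :: real
  assumes "\<delta> > 0" and "t \<in> grid \<delta>" and "T \<in> grid \<delta>" and "\<bar>t\<bar> < T"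
    and "s = t + \<delta> \<or> s = t - \<delta>" and "\<not> \<bar>s\<bar> < T"
  shows "s = T \<or> s = - T"
proof -
  obtain k m :: int where k: "t = \<delta> * k" and m: "T = \<delta> * m"
    using assms(2,3) by (auto simp: grid_real_iff)
  have "\<bar>real_of_int k\<bar> < real_of_int m"
    using assms(1,4) by (simp add: k m abs_mult)
  then have "\<bar>k\<bar> < m" by linarith
  have "s = \<delta> * (k + 1) \<or> s = \<delta> * (k - 1)"
    using assms(5) by (auto simp: k algebra_simps)
  then obtain j :: int where j: "s = \<delta> * j" "j = k + 1 \<or> j = k - 1"
    by (metis of_int_1 of_int_add of_int_diff)
  have "\<not> \<bar>real_of_int j\<bar> < real_of_int m"
    using assms(1,6) by (simp add: j(1) m abs_mult)
  then have "\<not> \<bar>j\<bar> < m" by linarith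
  with j(2) \<open>\<bar>k\<bar> < m\<close> have "j = m \<or> j = - m" by linarith
  then show ?thesis by (auto simp: j(1) m)
qed

lemma cosh_recurrence_comparison:
  fixes E :: "real \<Rightarrow> real"
  assumes "\<delta> > 0" and "T \<in> grid \<delta>"
    and growth: "\<And>s. s \<in> grid \<delta> \<Longrightarrow> \<bar>s\<bar> < T \<Longrightarrow> 2 * cosh (a * \<delta>) * E s \<le> E (s + \<delta>) + E (s - \<delta>)"
    and ends: "E T \<le> K * cosh (a * T)" "E (- T) \<le> K * cosh (a * T)"
    and t: "t \<in> grid \<delta>" "\<bar>t\<bar> \<le> T"
  shows "E t \<le> K * cosh (a * t)"
proof (cases "\<bar>t\<bar> = T")
  case True
  then have "t = T \<or> t = - T" by linarith
  then show ?thesis using ends by auto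
next
  case False
  define u where "u = (\<lambda>s. E s - K * cosh (a * s))"
  let ?S = "{s \<in> grid \<delta>. \<bar>s\<bar> < T}"
  have "u t \<le> 0"
  proof (rule discrete_maximum_principle[where S = ?S and u = u and x = t, OF \<open>\<delta> > 0\<close>])
    show "finite ?S"
      by (rule finite_subset[OF _ finite_grid_real[OF \<open>\<delta> > 0\<close>, of T]]) auto
    show "t \<in> ?S" using False t by auto
  next
    fix s assume s: "s \<in> ?S" and "u s > 0"
    have "cosh (a * (s + \<delta>)) + cosh (a * (s - \<delta>)) = 2 * cosh (a * \<delta>) * cosh (a * s)"
      by (simp add: ring_distribs cosh_add cosh_diff)
    then have "K * cosh (a * (s + \<delta>)) + K * cosh (a * (s - \<delta>)) = 2 * cosh (a * \<delta>) * (K * cosh (a * s))"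
      by (simp add: ring_distribs[symmetric] mult.left_commute del: distrib_left)
    then have "2 * cosh (a * \<delta>) * u s \<le> u (s + \<delta>) + u (s - \<delta>)"
      using growth[of s] s unfolding u_def by (simp add: right_diff_distrib)
    moreover have "2 * u s \<le> 2 * cosh (a * \<delta>) * u s"
      using cosh_real_ge_1[of "a * \<delta>"] \<open>u s > 0\<close> by simp
    ultimately show "dlaplacian \<delta> u s \<ge> 0"
      by (simp add: dlaplacian_real)
  next
    fix s s' assume "s \<in> ?S" "neighbors \<delta> s s'" "s' \<notin> ?S"
    then have "s \<in> grid \<delta>" "\<bar>s\<bar> < T" and step: "s' = s + \<delta> \<or> s' = s - \<delta>"
      by (auto simp: neighbors_real_iff)
    moreover from this have "s' \<in> grid \<delta>"
      using grid_real_plus grid_real_minus by auto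
    ultimately have "s' = T \<or> s' = - T"
      using grid_exit[OF \<open>\<delta> > 0\<close> _ \<open>T \<in> grid \<delta>\<close> _ step] \<open>s' \<notin> ?S\<close> by blast
    then show "u s' \<le> 0" using ends by (auto simp: u_def)
  qed
  then show ?thesis by (simp add: u_def)
qed

text \<open>The Euclidean norm of \<open>w\<close> on the horizontal slice at height \<open>t\<close>, not normalised by \<open>\<delta>\<close>.\<close>

definition slice_norm :: "'a set \<Rightarrow> ('a \<times> real \<Rightarrow> real) \<Rightarrow> real \<Rightarrow> real" where
  "slice_norm D w t = L2_set (\<lambda>x. w (x, t)) D"

lemma slice_norm_nonneg: "slice_norm D w t \<ge> 0"
  by (simp add: slice_norm_def L2_set_nonneg)

text \<open>
  Pairing the subharmonicity of \<open>w\<close> with \<open>w\<close> itself over one slice, the Rayleigh quotient bounds the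
  horizontal part of the Laplacian from below and the Cauchy-Schwarz inequality bounds the
  neighbouring slices from above.
\<close>

lemma slice_norm_growth:
  fixes \<Omega> :: "'a::euclidean_space set"
  assumes "\<delta> > 0" and "finite (dinterior \<Omega> \<delta>)" and "dinterior \<Omega> \<delta> \<noteq> {}"
    and nonneg: "\<And>p. w p \<ge> 0"
    and vanish: "\<And>x. x \<notin> dinterior \<Omega> \<delta> \<Longrightarrow> w (x, t) = 0"
    and sub: "\<And>x. x \<in> dinterior \<Omega> \<delta> \<Longrightarrow> dlaplacian \<delta> w (x, t) \<ge> 0"
  shows "(2 + \<delta>\<^sup>2 * first_eigenvalue \<Omega> \<delta>) * slice_norm (dinterior \<Omega> \<delta>) w t
    \<le> slice_norm (dinterior \<Omega> \<delta>) w (t + \<delta>) + slice_norm (dinterior \<Omega> \<delta>) w (t - \<delta>)"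
proof -
  define D where "D = dinterior \<Omega> \<delta>"
  define \<mu> where "\<mu> = first_eigenvalue \<Omega> \<delta>"
  let ?E = "slice_norm D w"
  have sq: "(?E t)\<^sup>2 = (\<Sum>x\<in>D. (w (x, t))\<^sup>2)"
    by (simp add: slice_norm_def L2_set_def sum_nonneg)
  have pt: "w (x, t) * w (x, t + \<delta>) + w (x, t) * w (x, t - \<delta>) \<ge>
      2 * (w (x, t))\<^sup>2 + \<delta>\<^sup>2 * (w (x, t) * - dlaplacian \<delta> (\<lambda>y. w (y, t)) x)" if "x \<in> D" for x
  proof -
    have "0 \<le> \<delta>\<^sup>2 * dlaplacian \<delta> w (x, t)"
      using sub that by (simp add: D_def)
    also have "\<dots> = \<delta>\<^sup>2 * dlaplacian \<delta> (\<lambda>y. w (y, t)) x + (w (x, t + \<delta>) + w (x, t - \<delta>) - 2 * w (x, t))"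
      using \<open>\<delta> > 0\<close> by (simp add: dlaplacian_prod dlaplacian_real distrib_left)
    finally have "0 \<le> w (x, t) * (\<delta>\<^sup>2 * dlaplacian \<delta> (\<lambda>y. w (y, t)) x + (w (x, t + \<delta>) + w (x, t - \<delta>) - 2 * w (x, t)))"
      using nonneg by simp
    then show ?thesis by (simp add: algebra_simps power2_eq_square)
  qed
  have CS: "(\<Sum>x\<in>D. w (x, t) * w (x, s)) \<le> ?E t * ?E s" for s
    using L2_set_mult_ineq[of "\<lambda>x. w (x, t)" "\<lambda>x. w (x, s)" D] nonneg
    by (simp add: slice_norm_def)
  have "(2 + \<delta>\<^sup>2 * \<mu>) * (?E t)\<^sup>2 = 2 * (?E t)\<^sup>2 + \<delta>\<^sup>2 * (\<mu> * (\<Sum>x\<in>D. (w (x, t))\<^sup>2))"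
    by (simp add: sq algebra_simps)
  also have "\<dots> \<le> 2 * (?E t)\<^sup>2 + \<delta>\<^sup>2 * dirichlet_form \<delta> D (\<lambda>y. w (y, t)) (\<lambda>y. w (y, t))"
    using first_eigenvalue_Rayleigh[OF assms(2,3), of "\<lambda>y. w (y, t)"] vanish
    unfolding D_def \<mu>_def by (intro add_left_mono mult_left_mono) auto
  also have "\<dots> = (\<Sum>x\<in>D. 2 * (w (x, t))\<^sup>2 + \<delta>\<^sup>2 * (w (x, t) * - dlaplacian \<delta> (\<lambda>y. w (y, t)) x))"
    unfolding sq dirichlet_form_def sum.distrib sum_distrib_left ..
  also have "\<dots> \<le> (\<Sum>x\<in>D. w (x, t) * w (x, t + \<delta>) + w (x, t) * w (x, t - \<delta>))"
    by (intro sum_mono pt)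
  also have "\<dots> \<le> ?E t * ?E (t + \<delta>) + ?E t * ?E (t - \<delta>)"
    unfolding sum.distrib by (intro add_mono CS)
  finally have main: "?E t * ((2 + \<delta>\<^sup>2 * \<mu>) * ?E t) \<le> ?E t * (?E (t + \<delta>) + ?E (t - \<delta>))"
    by (simp add: power2_eq_square algebra_simps)
  have "(2 + \<delta>\<^sup>2 * \<mu>) * ?E t \<le> ?E (t + \<delta>) + ?E (t - \<delta>)"
  proof (cases "?E t = 0")
    case True
    then show ?thesis using slice_norm_nonneg[of D w] by simp
  next
    case False
    then have "?E t > 0" using slice_norm_nonneg[of D w t] by simp
    with main show ?thesis by (simp only: mult_le_cancel_left_pos)
  qed
  then show ?thesis by (simp only: D_def \<mu>_def)
qed

lemma
  assumes "\<delta> > 0" and "first_eigenvalue \<Omega> \<delta> \<ge> 0"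
  shows first_rate_nonneg: "first_rate \<Omega> \<delta> \<ge> 0"
    and cosh_first_rate: "cosh (first_rate \<Omega> \<delta> * \<delta>) = 1 + \<delta>\<^sup>2 * first_eigenvalue \<Omega> \<delta> / 2"
  using assms by (simp_all add: first_rate_def)

text \<open>
  The growth factor of the slice norms is \<open>2 cosh (a \<delta>)\<close> with \<open>a\<close> the first rate, because
  \<open>cosh (a \<delta>) = 1 + \<delta>\<^sup>2 \<lambda> / 2\<close> for the first eigenvalue \<open>\<lambda>\<close>.
\<close>

corollary slice_norm_le_cosh:
  fixes \<Omega> :: "'a::euclidean_space set" and w :: "'a \<times> real \<Rightarrow> real"
  assumes "\<delta> > 0" and "finite (dinterior \<Omega> \<delta>)" and "dinterior \<Omega> \<delta> \<noteq> {}"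
    and "\<And>p. w p \<ge> 0"
    and "\<And>x t. x \<notin> dinterior \<Omega> \<delta> \<Longrightarrow> w (x, t) = 0"
    and "\<And>x t. x \<in> dinterior \<Omega> \<delta> \<Longrightarrow> t \<in> grid \<delta> \<Longrightarrow> \<bar>t\<bar> < T \<Longrightarrow> dlaplacian \<delta> w (x, t) \<ge> 0"
    and "T \<in> grid \<delta>"
    and "slice_norm (dinterior \<Omega> \<delta>) w T \<le> K * cosh (first_rate \<Omega> \<delta> * T)"
    and "slice_norm (dinterior \<Omega> \<delta>) w (- T) \<le> K * cosh (first_rate \<Omega> \<delta> * T)"
    and "t \<in> grid \<delta>" and "\<bar>t\<bar> \<le> T"
  shows "slice_norm (dinterior \<Omega> \<delta>) w t \<le> K * cosh (first_rate \<Omega> \<delta> * t)"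
proof (rule cosh_recurrence_comparison[OF \<open>\<delta> > 0\<close> assms(7) _ assms(8-11)])
  fix s :: real assume s: "s \<in> grid \<delta>" "\<bar>s\<bar> < T"
  have "2 * cosh (first_rate \<Omega> \<delta> * \<delta>) = 2 + \<delta>\<^sup>2 * first_eigenvalue \<Omega> \<delta>"
    using cosh_first_rate[OF \<open>\<delta> > 0\<close> first_eigenvalue_nonneg[OF assms(2,3)]] by simp
  then show "2 * cosh (first_rate \<Omega> \<delta> * \<delta>) * slice_norm (dinterior \<Omega> \<delta>) w s
      \<le> slice_norm (dinterior \<Omega> \<delta>) w (s + \<delta>) + slice_norm (dinterior \<Omega> \<delta>) w (s - \<delta>)"
    using slice_norm_growth[OF assms(1-5) assms(6), of s] s by simp
qed

text \<open>
  The positive part of \<open>h - F\<close> over \<open>D\<close>, extended by zero to all other columns.  If \<open>h\<close> is harmonic and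
  at most \<open>F\<close> on the lateral boundary, this function is subharmonic.
\<close>

definition excess :: "'a set \<Rightarrow> real \<Rightarrow> ('a \<times> real \<Rightarrow> real) \<Rightarrow> 'a \<times> real \<Rightarrow> real" where
  "excess D F h p = (if fst p \<in> D then max 0 (h p - F) else 0)"

lemma excess_nonneg: "excess D F h p \<ge> 0"
  and excess_outside: "x \<notin> D \<Longrightarrow> excess D F h (x, t) = 0"
  by (simp_all add: excess_def)

lemma excess_subharmonic:
  fixes h :: "'a::euclidean_space \<times> real \<Rightarrow> real"
  assumes "x \<in> dinterior \<Omega> \<delta>" and harmonic: "dlaplacian \<delta> h (x, t) = 0"
    and lateral: "\<And>y. y \<in> dboundary \<Omega> \<delta> \<Longrightarrow> h (y, t) \<le> F"
  shows "dlaplacian \<delta> (excess (dinterior \<Omega> \<delta>) F h) (x, t) \<ge> 0"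
proof (cases "h (x, t) \<le> F")
  case True
  have "dlaplacian \<delta> (\<lambda>_. 0) (x, t) \<le> dlaplacian \<delta> (excess (dinterior \<Omega> \<delta>) F h) (x, t)"
    by (rule dlaplacian_mono) (use True in \<open>simp_all add: excess_def\<close>)
  then show ?thesis by (simp add: dlaplacian_const)
next
  case False
  have le: "h (y, s) - F \<le> excess (dinterior \<Omega> \<delta>) F h (y, s)" if "neighbors \<delta> (x, t) (y, s)" for y s
  proof (cases "y \<in> dinterior \<Omega> \<delta>")
    case False
    with assms(1) have "y \<noteq> x" by blast
    with that have "neighbors \<delta> x y" "s = t" by (auto simp: neighbors_prod_real_iff)
    then show ?thesis
      using lateral[OF dboundary_neighbor[OF assms(1) _ False]] False by (simp add: excess_def)
  qed (simp add: excess_def)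
  have "dlaplacian \<delta> (\<lambda>p. h p - F) (x, t) \<le> dlaplacian \<delta> (excess (dinterior \<Omega> \<delta>) F h) (x, t)"
  proof (rule dlaplacian_mono)
    show "excess (dinterior \<Omega> \<delta>) F h (x, t) = h (x, t) - F"
      using False assms(1) by (simp add: excess_def)
  next
    fix b :: "'a \<times> real" assume b: "b \<in> Basis"
    show "h ((x, t) + \<delta> *\<^sub>R b) - F \<le> excess (dinterior \<Omega> \<delta>) F h ((x, t) + \<delta> *\<^sub>R b)"
      using le[of "fst ((x, t) + \<delta> *\<^sub>R b)" "snd ((x, t) + \<delta> *\<^sub>R b)"] neighbors_plus[OF b, of \<delta> "(x, t)"]
      by (simp only: prod.collapse)
    show "h ((x, t) - \<delta> *\<^sub>R b) - F \<le> excess (dinterior \<Omega> \<delta>) F h ((x, t) - \<delta> *\<^sub>R b)"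
      using le[of "fst ((x, t) - \<delta> *\<^sub>R b)" "snd ((x, t) - \<delta> *\<^sub>R b)"] neighbors_minus[OF b, of \<delta> "(x, t)"]
      by (simp only: prod.collapse)
  qed
  then show ?thesis by (simp add: dlaplacian_diff dlaplacian_const harmonic)
qed

section \<open>Phragmen-Lindelof principle in the infinite cylinder\<close>

lemma dharmonic_on_uminus: "dharmonic_on \<delta> h S \<Longrightarrow> dharmonic_on \<delta> (\<lambda>p. - h p) S"
  by (simp add: dharmonic_on_def dlaplacian_uminus)

text \<open>
  On slices at large height the norm of the positive part of \<open>h - B\<close> is at most a small multiple of
  \<open>cosh (a T)\<close>, hence the same multiple of \<open>cosh (a t)\<close> bounds it at every fixed height \<open>t\<close>.
\<close>

lemma phragmen_lindelof_upper:
  fixes \<Omega> :: "'a::euclidean_space set" and h :: "'a \<times> real \<Rightarrow> real"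
  assumes "\<delta> > 0" and fin: "finite (dinterior \<Omega> \<delta>)" and ne: "dinterior \<Omega> \<delta> \<noteq> {}" and "B \<ge> 0"
    and harmonic: "dharmonic_on \<delta> h (dinterior \<Omega> \<delta> \<times> grid \<delta>)"
    and small: "\<And>\<epsilon>. \<epsilon> > 0 \<Longrightarrow> \<exists>R>0. \<forall>x \<in> dinterior \<Omega> \<delta>. \<forall>t \<in> grid \<delta>.
           \<bar>t\<bar> \<ge> R \<longrightarrow> h (x, t) \<le> \<epsilon> * exp (first_rate \<Omega> \<delta> * \<bar>t\<bar>)"
    and lateral: "\<And>y t. y \<in> dboundary \<Omega> \<delta> \<Longrightarrow> t \<in> grid \<delta> \<Longrightarrow> h (y, t) \<le> B"
    and x: "x \<in> dinterior \<Omega> \<delta>" and t: "t \<in> grid \<delta>"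
  shows "h (x, t) \<le> B"
proof -
  define D where "D = dinterior \<Omega> \<delta>"
  define a where "a = first_rate \<Omega> \<delta>"
  let ?w = "excess D B h"
  have le_eps: "?w (x, t) \<le> e * (2 * real (card D) * cosh (a * t))" if "e > 0" for e
  proof -
    obtain R where R: "\<And>y s. y \<in> D \<Longrightarrow> s \<in> grid \<delta> \<Longrightarrow> \<bar>s\<bar> \<ge> R \<Longrightarrow> h (y, s) \<le> e * exp (a * \<bar>s\<bar>)"
      using small[OF \<open>e > 0\<close>] unfolding D_def a_def by blast
    obtain k :: nat where k: "max R \<bar>t\<bar> / \<delta> \<le> real k" using real_arch_simple by blast
    define T where "T = \<delta> * real k"
    have "T \<in> grid \<delta>" unfolding grid_real_iff T_def by (metis of_int_of_nat_eq)
    have "max R \<bar>t\<bar> \<le> T" using k \<open>\<delta> > 0\<close> by (simp add: T_def pos_divide_le_eq mult.commute)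
    then have "R \<le> T" "\<bar>t\<bar> \<le> T" by auto
    then have "T \<ge> 0" by linarith
    have w_le: "?w (y, s) \<le> 2 * e * cosh (a * T)" if "s \<in> grid \<delta>" "\<bar>s\<bar> = T" "y \<in> D" for y s
    proof -
      have "h (y, s) - B \<le> e * exp (a * T)"
        using R[of y s] that \<open>R \<le> T\<close> \<open>B \<ge> 0\<close> by simp
      also have "\<dots> \<le> e * (2 * cosh (a * T))"
        using \<open>e > 0\<close> by (intro mult_left_mono) (simp_all add: cosh_def)
      finally show ?thesis using \<open>e > 0\<close> that(3) by (simp add: excess_def)
    qed
    have E_le: "slice_norm D ?w s \<le> e * (2 * real (card D)) * cosh (a * T)" if "s \<in> grid \<delta>" "\<bar>s\<bar> = T" for s
    proof -
      have "slice_norm D ?w s \<le> (\<Sum>y\<in>D. ?w (y, s))"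
        unfolding slice_norm_def by (rule L2_set_le_sum) (simp add: excess_nonneg)
      also have "\<dots> \<le> (\<Sum>y\<in>D. 2 * e * cosh (a * T))" by (intro sum_mono w_le that)
      finally show ?thesis by (simp add: algebra_simps)
    qed
    have "slice_norm D ?w t \<le> e * (2 * real (card D)) * cosh (a * t)"
      unfolding D_def a_def
    proof (rule slice_norm_le_cosh[where T = T])
      show "dlaplacian \<delta> (excess (dinterior \<Omega> \<delta>) B h) (y, s) \<ge> 0"
        if "y \<in> dinterior \<Omega> \<delta>" "s \<in> grid \<delta>" for y s
        by (rule excess_subharmonic) (use that harmonic lateral in \<open>auto simp: dharmonic_on_def\<close>)
    qed (use assms \<open>T \<in> grid \<delta>\<close> grid_real_uminus[OF \<open>T \<in> grid \<delta>\<close>] \<open>\<bar>t\<bar> \<le> T\<close> \<open>T \<ge> 0\<close>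
          E_le[of T] E_le[of "- T"]
        in \<open>auto simp: excess_nonneg excess_outside D_def a_def\<close>)
    moreover have "?w (x, t) \<le> slice_norm D ?w t"
      unfolding slice_norm_def using fin x by (intro member_le_L2_set) (auto simp: D_def)
    ultimately show ?thesis by (simp add: mult.assoc)
  qed
  have "?w (x, t) \<le> 0"
  proof (rule field_le_epsilon)
    fix e :: real assume "e > 0"
    define c where "c = 2 * real (card D) * cosh (a * t)"
    have "c > 0" using fin ne by (simp add: c_def D_def card_gt_0_iff)
    then have "e / c > 0" "e / c * c = e" using \<open>e > 0\<close> by simp_all
    with le_eps[of "e / c"] show "?w (x, t) \<le> 0 + e" by (simp only: add_0 c_def)
  qed
  then show ?thesis using x by (simp add: excess_def D_def)
qed


section \<open>Elementary inequalities\<close>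

lemma sinh_ge_self: "0 \<le> (x::real) \<Longrightarrow> x \<le> sinh x"
  using real_le_x_sinh[of x] by (simp add: sinh_def exp_minus)

lemma cosh_ge_one_plus_square: "1 + x\<^sup>2 / 2 \<le> cosh (x::real)"
proof -
  have "(\<bar>x\<bar> / 2)\<^sup>2 \<le> (sinh (\<bar>x\<bar> / 2))\<^sup>2"
    by (intro power_mono sinh_ge_self) auto
  moreover have "cosh \<bar>x\<bar> = 1 + 2 * (sinh (\<bar>x\<bar> / 2))\<^sup>2"
    using cosh_double[of "\<bar>x\<bar> / 2"] by (simp add: cosh_square_eq)
  ultimately show ?thesis by (simp add: power_divide)
qed

lemma one_minus_cos_le: "1 - cos (x::real) \<le> x\<^sup>2 / 2"
proof -
  have "(sin (x / 2))\<^sup>2 \<le> (x / 2)\<^sup>2"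
    using abs_sin_x_le_abs_x[of "x / 2"] by (metis abs_le_square_iff)
  moreover have "1 - cos x = 2 * (sin (x / 2))\<^sup>2"
    using cos_double_sin[of "x / 2"] by simp
  ultimately show ?thesis by (simp add: power_divide)
qed

lemma half_le_sin:
  fixes y :: real
  assumes "0 \<le> y" and "y \<le> pi / 2"
  shows "y / 2 \<le> sin y"
proof -
  \<comment> \<open>from \<open>z cos z \<le> sin z\<close> at half the angle, \<open>sin y = 2 sin (y / 2) cos (y / 2) \<ge> y (1 + cos y) / 2\<close>\<close>
  have mono: "z * cos z \<le> sin z" if "0 \<le> z" "z \<le> pi" for z :: real
  proof -
    have "(\<lambda>z::real. sin z - z * cos z) 0 \<le> (\<lambda>z. sin z - z * cos z) z"
    proof (rule DERIV_nonneg_imp_nondecreasing[OF \<open>0 \<le> z\<close>])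
      fix x :: real assume x: "0 \<le> x" "x \<le> z"
      have "((\<lambda>z. sin z - z * cos z) has_real_derivative x * sin x) (at x)"
        by (auto intro!: derivative_eq_intros)
      moreover have "x * sin x \<ge> 0" using x that by (simp add: sin_ge_zero)
      ultimately show "\<exists>d. ((\<lambda>z. sin z - z * cos z) has_real_derivative d) (at x) \<and> 0 \<le> d" by blast
    qed
    then show ?thesis by simp
  qed
  have "0 \<le> cos (y / 2)" using assms by (intro cos_ge_zero) auto
  have "y / 2 \<le> y * (1 + cos y) / 2"
    using assms cos_ge_zero[of y] by (simp add: mult_le_cancel_left1)
  also have "\<dots> = 2 * (y / 2 * cos (y / 2)) * cos (y / 2)"
    using cos_double_cos[of "y / 2"] by (simp add: power2_eq_square)
  also have "\<dots> \<le> 2 * sin (y / 2) * cos (y / 2)"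
    using mono[of "y / 2"] assms \<open>0 \<le> cos (y / 2)\<close> by (intro mult_right_mono) auto
  also have "\<dots> = sin y" using sin_double[of "y / 2"] by simp
  finally show ?thesis .
qed

text \<open>
  Any factor small enough would serve in place of \<open>1 / 4\<close>.  The inequality makes the growth rates of the
  modes at least linear in their frequencies over the full range \<open>[0, \<pi>]\<close>.
\<close>

lemma cosh_quarter_le:
  fixes x :: real
  assumes "0 \<le> x" and "x \<le> pi"
  shows "cosh (x / 4) \<le> 2 - cos x"
proof -
  let ?z = "x / 8"
  have z: "0 \<le> ?z" "?z \<le> 1" using assms pi_less_4 by auto
  have "sinh ?z = (exp ?z - exp (- ?z)) / 2" by (simp add: sinh_def)
  also have "\<dots> \<le> ((1 + ?z + ?z\<^sup>2) - (1 - ?z)) / 2"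
    using exp_bound[OF z] exp_ge_add_one_self[of "- ?z"] by (intro divide_right_mono diff_mono) auto
  also have "\<dots> \<le> 2 * ?z"
    using z mult_left_le[of ?z ?z] by (simp add: power2_eq_square)
  also have "\<dots> \<le> sin (x / 2)" using half_le_sin[of "x / 2"] assms by simp
  finally have "(sinh ?z)\<^sup>2 \<le> (sin (x / 2))\<^sup>2"
    using z by (intro power_mono) auto
  moreover have "cosh (x / 4) = 1 + 2 * (sinh ?z)\<^sup>2"
    using cosh_double[of ?z] by (simp add: cosh_square_eq)
  moreover have "cos x = 1 - 2 * (sin (x / 2))\<^sup>2"
    using cos_double_sin[of "x / 2"] by simp
  ultimately show ?thesis by simp
qed

section \<open>Sine series in a cube\<close>

lemma sum_cos_multiples:
  fixes \<alpha> :: real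
  assumes "M > 0"
  shows "2 * sin (\<alpha> / 2) * (\<Sum>k\<in>{1..<M}. cos (real k * \<alpha>)) = sin (real M * \<alpha> - \<alpha> / 2) - sin (\<alpha> / 2)"
  using assms
proof (induction M)
  case (Suc M)
  show ?case
  proof (cases "M = 0")
    case False
    have "2 * sin (\<alpha> / 2) * cos (real M * \<alpha>) = sin (real M * \<alpha> + \<alpha> / 2) - sin (real M * \<alpha> - \<alpha> / 2)"
      by (simp add: sin_add sin_diff)
    then show ?thesis using Suc.IH False
      by (simp add: distrib_left distrib_right atLeastLessThanSuc add.commute)
  qed simp
qed simp

lemma sum_cos_multiples_of_pi_fraction:
  fixes q :: int
  assumes "q \<noteq> 0" and "\<bar>q\<bar> < 2 * int M"
  shows "(\<Sum>k\<in>{1..<M}. cos (real k * (pi * of_int q / real M))) = - (1 + cos (pi * of_int q)) / 2"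
proof -
  have "M > 0" using assms by simp
  let ?\<alpha> = "pi * of_int q / real M"
  have "sin (?\<alpha> / 2) \<noteq> 0"
  proof -
    have "sin \<bar>?\<alpha> / 2\<bar> > 0"
    proof (rule sin_gt_zero)
      show "\<bar>?\<alpha> / 2\<bar> > 0" using assms \<open>M > 0\<close> by simp
      have "real_of_int \<bar>q\<bar> < 2 * real M" using assms(2) by linarith
      then have "pi * real_of_int \<bar>q\<bar> < pi * (2 * real M)" by simp
      then show "\<bar>?\<alpha> / 2\<bar> < pi" using \<open>M > 0\<close> by (simp add: abs_mult pos_divide_less_eq)
    qed
    then show ?thesis by (auto simp: abs_if split: if_splits)
  qed
  have "sin (real M * ?\<alpha> - ?\<alpha> / 2) = - cos (pi * of_int q) * sin (?\<alpha> / 2)"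
    using \<open>M > 0\<close> by (simp add: sin_diff)
  with sum_cos_multiples[OF \<open>M > 0\<close>, of ?\<alpha>]
  have "sin (?\<alpha> / 2) * (2 * (\<Sum>k\<in>{1..<M}. cos (real k * ?\<alpha>))) = sin (?\<alpha> / 2) * (- cos (pi * of_int q) - 1)"
    by (simp add: algebra_simps)
  with \<open>sin (?\<alpha> / 2) \<noteq> 0\<close> have "2 * (\<Sum>k\<in>{1..<M}. cos (real k * ?\<alpha>)) = - cos (pi * of_int q) - 1"
    by (simp only: mult_cancel_left) simp
  then show ?thesis by simp
qed

lemma sine_orthogonality:
  fixes i j :: int
  assumes "0 < i" "i < int M" "0 < j" "j < int M"
  shows "(\<Sum>k\<in>{1..<M}. sin (pi * real k / real M * of_int i) * sin (pi * real k / real M * of_int j))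
    = (if i = j then real M / 2 else 0)"
proof -
  have "(\<Sum>k\<in>{1..<M}. sin (pi * real k / real M * of_int i) * sin (pi * real k / real M * of_int j))
    = (\<Sum>k\<in>{1..<M}. (cos (real k * (pi * of_int (i - j) / real M)) - cos (real k * (pi * of_int (i + j) / real M))) / 2)"
    by (intro sum.cong refl) (simp add: sin_times_sin algebra_simps add_divide_distrib diff_divide_distrib)
  also have "\<dots> = ((\<Sum>k\<in>{1..<M}. cos (real k * (pi * of_int (i - j) / real M)))
      - (\<Sum>k\<in>{1..<M}. cos (real k * (pi * of_int (i + j) / real M)))) / 2"
    by (simp only: sum_subtractf sum_divide_distrib[symmetric])
  also have "(\<Sum>k\<in>{1..<M}. cos (real k * (pi * of_int (i + j) / real M))) = - (1 + cos (pi * of_int (i + j))) / 2"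
    by (rule sum_cos_multiples_of_pi_fraction) (use assms in auto)
  also have "cos (pi * of_int (i + j)) = cos (pi * of_int (i - j))"
    by (simp add: ring_distribs cos_add cos_diff)
  finally have *: "(\<Sum>k\<in>{1..<M}. sin (pi * real k / real M * of_int i) * sin (pi * real k / real M * of_int j))
    = ((\<Sum>k\<in>{1..<M}. cos (real k * (pi * of_int (i - j) / real M))) + (1 + cos (pi * of_int (i - j))) / 2) / 2"
    by (simp only: minus_divide_left[symmetric] diff_minus_eq_add)
  show ?thesis
  proof (cases "i = j")
    case True
    have "real (M - 1) = real M - 1" using assms by (simp add: of_nat_diff)
    then show ?thesis unfolding * using True by simp
  next
    case False
    have "(\<Sum>k\<in>{1..<M}. cos (real k * (pi * of_int (i - j) / real M))) = - (1 + cos (pi * of_int (i - j))) / 2"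
      by (rule sum_cos_multiples_of_pi_fraction) (use assms False in auto)
    then have "(\<Sum>k\<in>{1..<M}. cos (real k * (pi * of_int (i - j) / real M))) + (1 + cos (pi * of_int (i - j))) / 2 = 0"
      by (simp only: minus_divide_left[symmetric] left_minus)
    then show ?thesis unfolding * using False by (simp only:) simp
  qed
qed

text \<open>
  The Dirichlet eigenfunctions of the cube of half-width \<open>\<delta> K\<close> are products of sines, indexed by
  functions \<open>k\<close> from the coordinate directions to \<open>{1..<2 * K}\<close>; the frequency belonging to the index
  \<open>m\<close> in one direction is \<open>\<pi> m / (2 K)\<close> per lattice step.  The coordinate is shifted by \<open>K\<close> steps so
  that one face of the cube sits at \<open>0\<close>.
\<close>

definition mode_indices :: "nat \<Rightarrow> ('a::euclidean_space \<Rightarrow> nat) set" where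
  "mode_indices K = (\<Pi>\<^sub>E b\<in>Basis. {1..<2 * K})"

definition frequency :: "nat \<Rightarrow> nat \<Rightarrow> real" where
  "frequency K m = pi * real m / real (2 * K)"

definition sine_mode :: "real \<Rightarrow> nat \<Rightarrow> ('a::euclidean_space \<Rightarrow> nat) \<Rightarrow> 'a \<Rightarrow> real" where
  "sine_mode \<delta> K k x = (\<Prod>b\<in>Basis. sin (frequency K (k b) * (x \<bullet> b / \<delta> + real K)))"

text \<open>The rate at which the harmonic function with cross-section \<open>sine_mode \<delta> K k\<close> grows along the axis.\<close>

definition mode_rate :: "real \<Rightarrow> nat \<Rightarrow> ('a::euclidean_space \<Rightarrow> nat) \<Rightarrow> real" where
  "mode_rate \<delta> K k = arcosh (1 + (\<Sum>b\<in>Basis. 1 - cos (frequency K (k b)))) / \<delta>"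

lemma finite_mode_indices: "finite (mode_indices K :: ('a::euclidean_space \<Rightarrow> nat) set)"
  unfolding mode_indices_def by (intro finite_PiE) auto

lemma abs_sine_mode_le: "\<bar>sine_mode \<delta> K k x\<bar> \<le> 1"
  unfolding sine_mode_def abs_prod by (intro prod_le_1) auto

lemma cosh_mode_rate:
  assumes "\<delta> > 0"
  shows "cosh (mode_rate \<delta> K k * \<delta>) = 1 + (\<Sum>b\<in>Basis. 1 - cos (frequency K (k b)))"
proof -
  have "(\<Sum>b\<in>Basis. 1 - cos (frequency K (k b))) \<ge> 0" by (intro sum_nonneg) simp
  then show ?thesis using assms by (simp add: mode_rate_def)
qed

lemma mode_rate_nonneg: "\<delta> > 0 \<Longrightarrow> mode_rate \<delta> K k \<ge> 0"
proof -
  have "(\<Sum>b\<in>Basis. 1 - cos (frequency K (k b))) \<ge> 0" by (intro sum_nonneg) simp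
  then show "\<delta> > 0 \<Longrightarrow> mode_rate \<delta> K k \<ge> 0" by (simp add: mode_rate_def)
qed

lemma sine_mode_neighbors:
  fixes c :: "'a::euclidean_space"
  assumes "\<delta> > 0" and "c \<in> Basis"
  shows "sine_mode \<delta> K k (x + \<delta> *\<^sub>R c) + sine_mode \<delta> K k (x - \<delta> *\<^sub>R c) = 2 * cos (frequency K (k c)) * sine_mode \<delta> K k x"
proof -
  let ?\<theta> = "\<lambda>b. frequency K (k b)"
  let ?rest = "\<Prod>b\<in>Basis - {c}. sin (?\<theta> b * (x \<bullet> b / \<delta> + real K))"
  have split: "sine_mode \<delta> K k y = sin (?\<theta> c * (y \<bullet> c / \<delta> + real K)) * ?rest"
    if "\<And>b. b \<in> Basis - {c} \<Longrightarrow> y \<bullet> b = x \<bullet> b" for y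
  proof -
    have "sine_mode \<delta> K k y = sin (?\<theta> c * (y \<bullet> c / \<delta> + real K)) *
        (\<Prod>b\<in>Basis - {c}. sin (?\<theta> b * (y \<bullet> b / \<delta> + real K)))"
      unfolding sine_mode_def by (rule prod.remove) (use assms in auto)
    then show ?thesis using that by simp
  qed
  have "(x + \<delta> *\<^sub>R c) \<bullet> c / \<delta> = x \<bullet> c / \<delta> + 1" "(x - \<delta> *\<^sub>R c) \<bullet> c / \<delta> = x \<bullet> c / \<delta> - 1"
    using assms by (simp_all add: inner_simps add_divide_distrib diff_divide_distrib)
  moreover have "sine_mode \<delta> K k (x + \<delta> *\<^sub>R c) = sin (?\<theta> c * ((x + \<delta> *\<^sub>R c) \<bullet> c / \<delta> + real K)) * ?rest"
    by (rule split) (use \<open>c \<in> Basis\<close> in \<open>auto simp: inner_simps inner_Basis\<close>)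
  moreover have "sine_mode \<delta> K k (x - \<delta> *\<^sub>R c) = sin (?\<theta> c * ((x - \<delta> *\<^sub>R c) \<bullet> c / \<delta> + real K)) * ?rest"
    by (rule split) (use \<open>c \<in> Basis\<close> in \<open>auto simp: inner_simps inner_Basis\<close>)
  moreover have "sine_mode \<delta> K k x = sin (?\<theta> c * (x \<bullet> c / \<delta> + real K)) * ?rest"
    by (rule split) simp
  moreover have "sin (?\<theta> c * (x \<bullet> c / \<delta> + 1 + real K)) + sin (?\<theta> c * (x \<bullet> c / \<delta> - 1 + real K))
      = 2 * cos (?\<theta> c) * sin (?\<theta> c * (x \<bullet> c / \<delta> + real K))"
    using sin_add[of "?\<theta> c * (x \<bullet> c / \<delta> + real K)" "?\<theta> c"] sin_diff[of "?\<theta> c * (x \<bullet> c / \<delta> + real K)" "?\<theta> c"]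
    by (simp add: algebra_simps)
  ultimately show ?thesis
    by (simp only: distrib_right[symmetric] mult.assoc[symmetric])
qed

lemma dlaplacian_sine_mode:
  fixes x :: "'a::euclidean_space"
  assumes "\<delta> > 0"
  shows "dlaplacian \<delta> (sine_mode \<delta> K k) x = - (2 * (\<Sum>b\<in>Basis. 1 - cos (frequency K (k b)))) / \<delta>\<^sup>2 * sine_mode \<delta> K k x"
proof -
  have "(\<Sum>b\<in>Basis. sine_mode \<delta> K k (x + \<delta> *\<^sub>R b) + sine_mode \<delta> K k (x - \<delta> *\<^sub>R b) - 2 * sine_mode \<delta> K k x)
      = (\<Sum>b\<in>Basis. - (2 * (1 - cos (frequency K (k b)))) * sine_mode \<delta> K k x)"
  proof (rule sum.cong[OF refl])
    fix b :: 'a assume "b \<in> Basis"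
    from sine_mode_neighbors[OF assms this, of K k x]
    show "sine_mode \<delta> K k (x + \<delta> *\<^sub>R b) + sine_mode \<delta> K k (x - \<delta> *\<^sub>R b) - 2 * sine_mode \<delta> K k x
        = - (2 * (1 - cos (frequency K (k b)))) * sine_mode \<delta> K k x"
      by (simp add: algebra_simps)
  qed
  then show ?thesis
    by (simp only: dlaplacian_eq_sum_second_differences sum_distrib_right[symmetric] sum_negf
        sum_distrib_left[symmetric] times_divide_eq_left)
qed

lemma dlaplacian_cosh:
  assumes "\<delta> > 0"
  shows "dlaplacian \<delta> (\<lambda>t. cosh (a * t)) t = 2 * (cosh (a * \<delta>) - 1) / \<delta>\<^sup>2 * cosh (a * t)"
proof -
  have "cosh (a * (t + \<delta>)) + cosh (a * (t - \<delta>)) = 2 * cosh (a * \<delta>) * cosh (a * t)"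
    by (simp add: distrib_left right_diff_distrib cosh_add cosh_diff)
  then show ?thesis by (simp add: dlaplacian_real left_diff_distrib right_diff_distrib)
qed

lemma dlaplacian_sine_mode_cosh:
  assumes "\<delta> > 0"
  shows "dlaplacian \<delta> (\<lambda>p. sine_mode \<delta> K k (fst p) * cosh (mode_rate \<delta> K k * snd p)) (x, t) = 0"
proof -
  have "dlaplacian \<delta> (\<lambda>y. cosh (mode_rate \<delta> K k * t) * sine_mode \<delta> K k y) x
      = cosh (mode_rate \<delta> K k * t) * dlaplacian \<delta> (sine_mode \<delta> K k) x"
    by (rule dlaplacian_cmult)
  then show ?thesis
    by (simp add: dlaplacian_prod dlaplacian_cmult dlaplacian_cosh[OF assms] cosh_mode_rate[OF assms]
        dlaplacian_sine_mode[OF assms] mult.commute[of _ "cosh (mode_rate \<delta> K k * t)"])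
qed

lemma sine_mode_completeness:
  fixes x y :: "'a::euclidean_space"
  assumes "\<delta> > 0" and x: "x \<in> cube_points \<delta> K" and y: "y \<in> cube_points \<delta> K"
  shows "(\<Sum>k\<in>mode_indices K. sine_mode \<delta> K k x * sine_mode \<delta> K k y) = (if x = y then real K ^ DIM('a) else 0)"
proof -
  have coord: "(\<Sum>m\<in>{1..<2 * K}. sin (frequency K m * (x \<bullet> b / \<delta> + real K)) * sin (frequency K m * (y \<bullet> b / \<delta> + real K)))
      = (if x \<bullet> b = y \<bullet> b then real K else 0)" if "b \<in> Basis" for b
  proof -
    have "x \<in> grid \<delta>" "y \<in> grid \<delta>" using x y by (auto simp: cube_points_def)
    obtain i :: int where i: "x \<bullet> b = \<delta> * i"
      using \<open>x \<in> grid \<delta>\<close> \<open>b \<in> Basis\<close> by (rule grid_coordinate)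
    obtain j :: int where j: "y \<bullet> b = \<delta> * j"
      using \<open>y \<in> grid \<delta>\<close> \<open>b \<in> Basis\<close> by (rule grid_coordinate)
    have "\<bar>x \<bullet> b\<bar> < \<delta> * real K" "\<bar>y \<bullet> b\<bar> < \<delta> * real K"
      using x y that by (auto simp: cube_points_def)
    then have "\<bar>real_of_int i\<bar> < real K" "\<bar>real_of_int j\<bar> < real K"
      using assms(1) by (simp_all add: i j abs_mult)
    then have "0 < i + int K" "i + int K < int (2 * K)" "0 < j + int K" "j + int K < int (2 * K)"
      by linarith+
    from sine_orthogonality[OF this] show ?thesis
      using assms(1) by (simp add: i j frequency_def)
  qed
  have "(\<Sum>k\<in>mode_indices K. sine_mode \<delta> K k x * sine_mode \<delta> K k y) =
      (\<Sum>k\<in>mode_indices K. \<Prod>b\<in>Basis. sin (frequency K (k b) * (x \<bullet> b / \<delta> + real K)) * sin (frequency K (k b) * (y \<bullet> b / \<delta> + real K)))"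
    by (simp add: sine_mode_def prod.distrib)
  also have "\<dots> = (\<Prod>b\<in>Basis. \<Sum>m\<in>{1..<2 * K}. sin (frequency K m * (x \<bullet> b / \<delta> + real K)) * sin (frequency K m * (y \<bullet> b / \<delta> + real K)))"
    unfolding mode_indices_def by (subst prod_sum_PiE) auto
  also have "\<dots> = (\<Prod>b\<in>(Basis::'a set). if x \<bullet> b = y \<bullet> b then real K else 0)"
    by (intro prod.cong refl coord)
  also have "\<dots> = (if x = y then real K ^ DIM('a) else 0)"
  proof (cases "x = y")
    case False
    then obtain b :: 'a where "b \<in> Basis" "x \<bullet> b \<noteq> y \<bullet> b" using euclidean_eqI by metis
    then have "(\<Prod>b\<in>(Basis::'a set). if x \<bullet> b = y \<bullet> b then real K else 0) = 0"
      by (intro prod_zero) auto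
    then show ?thesis using False by simp
  qed simp
  finally show ?thesis .
qed

lemma sine_mode_vanishes_outside:
  fixes x y :: "'a::euclidean_space"
  assumes "\<delta> > 0" and "K > 0" and x: "x \<in> cube_points \<delta> K" and "neighbors \<delta> x y" and y: "y \<notin> cube_points \<delta> K"
  shows "sine_mode \<delta> K k y = 0"
proof -
  have "x \<in> grid \<delta>" using x by (simp add: cube_points_def)
  then have "y \<in> grid \<delta>" using grid_neighbors assms(4) by blast
  then obtain b where b: "b \<in> Basis" and out: "\<not> \<bar>y \<bullet> b\<bar> < \<delta> * real K"
    using y by (auto simp: cube_points_def)
  obtain c where c: "c \<in> Basis" "y = x + \<delta> *\<^sub>R c \<or> y = x - \<delta> *\<^sub>R c"
    using assms(4) by (auto simp: neighbors_def)
  have "\<bar>x \<bullet> b\<bar> < \<delta> * real K" using x b by (auto simp: cube_points_def)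
  have "x \<bullet> b \<in> grid \<delta>" unfolding grid_real_iff using grid_coordinate[OF \<open>x \<in> grid \<delta>\<close> b] by metis
  have "\<delta> * real K \<in> grid \<delta>" unfolding grid_real_iff by (metis of_int_of_nat_eq)
  have "b = c"
  proof (rule ccontr)
    assume "b \<noteq> c"
    then have "y \<bullet> b = x \<bullet> b" using b c by (auto simp: inner_simps inner_Basis)
    then show False using out \<open>\<bar>x \<bullet> b\<bar> < \<delta> * real K\<close> by simp
  qed
  then have "y \<bullet> b = x \<bullet> b + \<delta> \<or> y \<bullet> b = x \<bullet> b - \<delta>" using c by (auto simp: inner_simps)
  then have "y \<bullet> b = \<delta> * real K \<or> y \<bullet> b = - (\<delta> * real K)"
    by (rule grid_exit[OF assms(1) \<open>x \<bullet> b \<in> grid \<delta>\<close> \<open>\<delta> * real K \<in> grid \<delta>\<close> \<open>\<bar>x \<bullet> b\<bar> < \<delta> * real K\<close> _ out])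
  then have "y \<bullet> b / \<delta> + real K = real (2 * K) \<or> y \<bullet> b / \<delta> + real K = 0"
    using assms(1) by auto
  then have "sin (frequency K (k b) * (y \<bullet> b / \<delta> + real K)) = 0"
    using \<open>K > 0\<close> by (auto simp: frequency_def mult.commute[of pi])
  then show ?thesis unfolding sine_mode_def using b by (intro prod_zero) auto
qed


text \<open>
  A subharmonic function on the cylinder of half-height \<open>H\<close> over the cube that vanishes outside it is
  dominated by the sine series with data \<open>g\<close> on both ends.  Its value in the middle is
  therefore bounded by the \<open>l\<^sup>1\<close> norm of \<open>g\<close>.
\<close>

lemma subharmonic_middle_bound:
  fixes v :: "'a::euclidean_space \<times> real \<Rightarrow> real"
  assumes "\<delta> > 0" and "K > 0" and "H \<in> grid \<delta>" and "H > 0"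
    and vanish: "\<And>x t. x \<notin> cube_points \<delta> K \<Longrightarrow> v (x, t) = 0"
    and sub: "\<And>x t. x \<in> cube_points \<delta> K \<Longrightarrow> t \<in> grid \<delta> \<Longrightarrow> \<bar>t\<bar> < H \<Longrightarrow> dlaplacian \<delta> v (x, t) \<ge> 0"
    and ends: "\<And>x. x \<in> cube_points \<delta> K \<Longrightarrow> v (x, H) \<le> g x" "\<And>x. x \<in> cube_points \<delta> K \<Longrightarrow> v (x, - H) \<le> g x"
    and g: "\<And>x. g x \<ge> 0"
    and x: "x \<in> cube_points \<delta> K"
  shows "v (x, 0) \<le> (1 / real K) ^ DIM('a) *
    (\<Sum>k\<in>(mode_indices K :: ('a \<Rightarrow> nat) set). 1 / cosh (mode_rate \<delta> K k * H)) * (\<Sum>y\<in>cube_points \<delta> K. g y)"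
proof -
  let ?Q = "cube_points \<delta> K :: 'a set" and ?I = "mode_indices K :: ('a \<Rightarrow> nat) set"
  have finQ: "finite ?Q" using finite_cube_points[OF \<open>\<delta> > 0\<close>] .
  have finI: "finite ?I" by (rule finite_mode_indices)
  define c where "c = (\<lambda>k. (\<Sum>y\<in>?Q. sine_mode \<delta> K k y * g y) / (real K ^ DIM('a) * cosh (mode_rate \<delta> K k * H)))"
  define U where "U = (\<lambda>p. \<Sum>k\<in>?I. c k * (sine_mode \<delta> K k (fst p) * cosh (mode_rate \<delta> K k * snd p)))"
  have U_harmonic: "dlaplacian \<delta> U (y, t) = 0" for y t
    unfolding U_def by (simp only: dlaplacian_sum[OF finI] dlaplacian_cmult dlaplacian_sine_mode_cosh[OF \<open>\<delta> > 0\<close>]) simp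
  have U_end: "U (y, t) = g y" if y: "y \<in> ?Q" and t: "t = H \<or> t = - H" for y t
  proof -
    have "U (y, t) = (\<Sum>k\<in>?I. \<Sum>z\<in>?Q. g z / real K ^ DIM('a) * (sine_mode \<delta> K k y * sine_mode \<delta> K k z))"
      unfolding U_def
    proof (rule sum.cong[OF refl])
      fix k :: "'a \<Rightarrow> nat"
      have "cosh (mode_rate \<delta> K k * t) = cosh (mode_rate \<delta> K k * H)" using t by auto
      then have "c k * (sine_mode \<delta> K k (fst (y, t)) * cosh (mode_rate \<delta> K k * snd (y, t)))
          = (\<Sum>z\<in>?Q. sine_mode \<delta> K k z * g z) * (sine_mode \<delta> K k y / real K ^ DIM('a))"
        using cosh_real_pos[of "mode_rate \<delta> K k * H"] by (simp only: c_def fst_conv snd_conv) simp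
      also have "\<dots> = (\<Sum>z\<in>?Q. g z / real K ^ DIM('a) * (sine_mode \<delta> K k y * sine_mode \<delta> K k z))"
        unfolding sum_distrib_right by (intro sum.cong refl) simp
      finally show "c k * (sine_mode \<delta> K k (fst (y, t)) * cosh (mode_rate \<delta> K k * snd (y, t)))
          = (\<Sum>z\<in>?Q. g z / real K ^ DIM('a) * (sine_mode \<delta> K k y * sine_mode \<delta> K k z))" .
    qed
    also have "\<dots> = (\<Sum>z\<in>?Q. g z / real K ^ DIM('a) * (\<Sum>k\<in>?I. sine_mode \<delta> K k y * sine_mode \<delta> K k z))"
      by (subst sum.swap) (simp only: sum_distrib_left)
    also have "\<dots> = (\<Sum>z\<in>?Q. if z = y then g y else 0)"
      using \<open>K > 0\<close> y by (intro sum.cong refl) (auto simp: sine_mode_completeness[OF \<open>\<delta> > 0\<close>])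
    also have "\<dots> = g y" using finQ y by simp
    finally show ?thesis .
  qed
  let ?T = "{t \<in> grid \<delta>. \<bar>t\<bar> < H}"
  have "v (x, 0) - U (x, 0) \<le> 0"
  proof (rule discrete_maximum_principle[where S = "?Q \<times> ?T" and u = "\<lambda>p. v p - U p" and x = "(x, 0)", OF \<open>\<delta> > 0\<close>])
    have "finite ?T"
      by (rule finite_subset[OF _ finite_grid_real[OF \<open>\<delta> > 0\<close>, of H]]) auto
    then show "finite (?Q \<times> ?T)" using finQ by blast
    have "(0::real) \<in> grid \<delta>" unfolding grid_real_iff by (metis mult_zero_right of_int_0)
    then show "(x, 0) \<in> ?Q \<times> ?T" using x \<open>H > 0\<close> by simp
  next
    fix p assume "p \<in> ?Q \<times> ?T"
    then obtain y t where p: "p = (y, t)" "y \<in> ?Q" "t \<in> grid \<delta>" "\<bar>t\<bar> < H" by auto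
    show "dlaplacian \<delta> (\<lambda>p. v p - U p) p \<ge> 0"
      using sub[OF p(2-4)] by (simp add: p(1) dlaplacian_diff U_harmonic)
  next
    fix p p' assume "p \<in> ?Q \<times> ?T" and nb: "neighbors \<delta> p p'" and out: "p' \<notin> ?Q \<times> ?T"
    then obtain y t where p: "p = (y, t)" "y \<in> ?Q" "t \<in> grid \<delta>" "\<bar>t\<bar> < H" by auto
    obtain y' t' where p': "p' = (y', t')" by (cases p')
    consider "neighbors \<delta> y y'" "t' = t" | "y' = y" "t' = t + \<delta> \<or> t' = t - \<delta>"
      using nb by (auto simp: p p' neighbors_prod_real_iff)
    then show "v p' - U p' \<le> 0"
    proof cases
      case 1
      with out p have "y' \<notin> ?Q" by (auto simp: p')
      then show ?thesis
        using sine_mode_vanishes_outside[OF \<open>\<delta> > 0\<close> \<open>K > 0\<close> p(2) 1(1)] vanish by (simp add: p' U_def)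
    next
      case 2
      have "t' \<in> grid \<delta>" using 2(2) grid_real_plus[OF p(3)] grid_real_minus[OF p(3)] by auto
      with out p 2 have "\<not> \<bar>t'\<bar> < H" by (auto simp: p')
      then have "t' = H \<or> t' = - H"
        using grid_exit[OF \<open>\<delta> > 0\<close> p(3) \<open>H \<in> grid \<delta>\<close> p(4) 2(2)] by blast
      then show ?thesis using U_end[OF p(2), of t'] ends p(2) by (auto simp: p' 2(1))
    qed
  qed
  then have "v (x, 0) \<le> U (x, 0)" by simp
  also have "\<dots> \<le> (\<Sum>k\<in>?I. (\<Sum>y\<in>?Q. g y) * (1 / real K ^ DIM('a) * (1 / cosh (mode_rate \<delta> K k * H))))"
    unfolding U_def
  proof (rule sum_mono)
    fix k :: "'a \<Rightarrow> nat"
    have "\<bar>\<Sum>y\<in>?Q. sine_mode \<delta> K k y * g y\<bar> \<le> (\<Sum>y\<in>?Q. g y)"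
    proof (rule order_trans[OF sum_abs], rule sum_mono)
      fix y show "\<bar>sine_mode \<delta> K k y * g y\<bar> \<le> g y"
        using mult_right_mono[OF abs_sine_mode_le[of \<delta> K k y] g[of y]] g[of y] by (simp add: abs_mult)
    qed
    then have "\<bar>c k\<bar> \<le> (\<Sum>y\<in>?Q. g y) / (real K ^ DIM('a) * cosh (mode_rate \<delta> K k * H))"
      unfolding c_def abs_divide by (simp add: abs_mult divide_right_mono)
    moreover have "c k * sine_mode \<delta> K k x \<le> \<bar>c k\<bar>"
      using mult_left_mono[OF abs_sine_mode_le[of \<delta> K k x], of "\<bar>c k\<bar>"] abs_ge_self[of "c k * sine_mode \<delta> K k x"]
      by (simp add: abs_mult)
    ultimately show "c k * (sine_mode \<delta> K k (fst (x, 0)) * cosh (mode_rate \<delta> K k * snd (x, 0)))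
        \<le> (\<Sum>y\<in>?Q. g y) * (1 / real K ^ DIM('a) * (1 / cosh (mode_rate \<delta> K k * H)))"
      by simp
  qed
  also have "\<dots> = (1 / real K) ^ DIM('a) * (\<Sum>k\<in>?I. 1 / cosh (mode_rate \<delta> K k * H)) * (\<Sum>y\<in>?Q. g y)"
    by (simp add: sum_distrib_left sum_distrib_right power_divide mult.commute)
  finally show ?thesis .
qed

lemma inverse_cosh_le: "1 / cosh x \<le> 2 * exp (- (x::real))"
proof -
  have "exp x \<le> 2 * cosh x" by (simp add: cosh_def)
  then have "1 \<le> 2 * cosh x * exp (- x)"
    by (simp add: exp_minus field_simps)
  then show ?thesis by (simp add: pos_divide_le_eq algebra_simps)
qed

text \<open>
  The rate of a mode is at least linear in each of its indices, uniformly in the lattice spacing.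
\<close>

lemma mode_rate_ge:
  fixes k :: "'a::euclidean_space \<Rightarrow> nat"
  assumes "\<delta> > 0" and "K > 0" and k: "k \<in> mode_indices K" and b: "b \<in> Basis"
  shows "pi / (8 * (\<delta> * real K)) * real (k b) \<le> mode_rate \<delta> K k"
proof -
  let ?\<theta> = "\<lambda>b. frequency K (k b)"
  have "k b < 2 * K" using k b by (auto simp: mode_indices_def PiE_iff)
  then have "pi * real (k b) \<le> pi * real (2 * K)" by (intro mult_left_mono) auto
  then have \<theta>: "0 \<le> ?\<theta> b" "?\<theta> b \<le> pi"
    using \<open>K > 0\<close> by (simp_all add: frequency_def pos_divide_le_eq)
  have "cosh (?\<theta> b / 4) \<le> 1 + (1 - cos (?\<theta> b))" using cosh_quarter_le[OF \<theta>] by simp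
  also have "1 - cos (?\<theta> b) \<le> (\<Sum>b\<in>Basis. 1 - cos (?\<theta> b))"
    using b by (intro member_le_sum) auto
  finally have "cosh (?\<theta> b / 4) \<le> cosh (mode_rate \<delta> K k * \<delta>)"
    unfolding cosh_mode_rate[OF \<open>\<delta> > 0\<close>] by simp
  then have "?\<theta> b / 4 \<le> mode_rate \<delta> K k * \<delta>"
    using \<theta> mode_rate_nonneg[OF \<open>\<delta> > 0\<close>, of K k] \<open>\<delta> > 0\<close> by (subst (asm) cosh_real_nonneg_le_iff) auto
  then show ?thesis
    using \<open>\<delta> > 0\<close> \<open>K > 0\<close> by (simp add: frequency_def field_simps)
qed

text \<open>The sum depends on \<open>\<delta>\<close> only through the half-width \<open>\<delta> K\<close> of the cube.\<close>

lemma sum_inverse_cosh_mode_rate_le: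
  assumes "\<delta> > 0" and "K > 0" and "H > 0"
  defines "q \<equiv> exp (- (pi * H / (8 * (\<delta> * real K) * real DIM('a::euclidean_space))))"
  shows "(\<Sum>k\<in>(mode_indices K :: ('a \<Rightarrow> nat) set). 1 / cosh (mode_rate \<delta> K k * H)) \<le> 2 * (1 / (1 - q)) ^ DIM('a)"
proof -
  let ?n = "real DIM('a)" and ?I = "mode_indices K :: ('a \<Rightarrow> nat) set"
  have "q < 1" "q > 0" using assms by (simp_all add: q_def)
  have "1 / cosh (mode_rate \<delta> K k * H) \<le> 2 * (\<Prod>b\<in>Basis. q ^ k b)" if "k \<in> ?I" for k
  proof -
    have "(\<Sum>b\<in>(Basis::'a set). pi / (8 * (\<delta> * real K)) * real (k b)) \<le> (\<Sum>b\<in>(Basis::'a set). mode_rate \<delta> K k)"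
      by (intro sum_mono mode_rate_ge assms that)
    then have "(\<Sum>b\<in>(Basis::'a set). pi / (8 * (\<delta> * real K)) * real (k b)) / ?n \<le> mode_rate \<delta> K k"
      by (simp add: pos_divide_le_eq mult.commute)
    then have "(\<Sum>b\<in>(Basis::'a set). pi / (8 * (\<delta> * real K)) * real (k b)) / ?n * H \<le> mode_rate \<delta> K k * H"
      using \<open>H > 0\<close> by (intro mult_right_mono) auto
    moreover have "(\<Sum>b\<in>(Basis::'a set). pi / (8 * (\<delta> * real K)) * real (k b)) / ?n * H
        = (\<Sum>b\<in>(Basis::'a set). real (k b) * (pi * H / (8 * (\<delta> * real K) * ?n)))"
      unfolding sum_divide_distrib sum_distrib_right by (intro sum.cong refl) simp
    ultimately have "- (mode_rate \<delta> K k * H) \<le> (\<Sum>b\<in>(Basis::'a set). real (k b) * - (pi * H / (8 * (\<delta> * real K) * ?n)))"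
      by (simp add: sum_negf)
    then have "exp (- (mode_rate \<delta> K k * H)) \<le> exp (\<Sum>b\<in>(Basis::'a set). real (k b) * - (pi * H / (8 * (\<delta> * real K) * ?n)))"
      by (simp only: exp_le_cancel_iff)
    also have "\<dots> = (\<Prod>b\<in>Basis. q ^ k b)"
      unfolding q_def by (simp only: exp_sum finite_Basis exp_of_nat_mult)
    finally show ?thesis using inverse_cosh_le[of "mode_rate \<delta> K k * H"] by linarith
  qed
  then have "(\<Sum>k\<in>?I. 1 / cosh (mode_rate \<delta> K k * H)) \<le> (\<Sum>k\<in>?I. 2 * (\<Prod>b\<in>Basis. q ^ k b))"
    by (rule sum_mono)
  also have "\<dots> = 2 * (\<Prod>b\<in>(Basis::'a set). \<Sum>m\<in>{1..<2 * K}. q ^ m)"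
    unfolding mode_indices_def sum_distrib_left[symmetric] by (subst prod_sum_PiE) auto
  also have "\<dots> = 2 * (\<Sum>m\<in>{1..<2 * K}. q ^ m) ^ DIM('a)" by simp
  also have "\<dots> \<le> 2 * (1 / (1 - q)) ^ DIM('a)"
  proof (intro mult_left_mono power_mono)
    have "(\<Sum>m\<in>{1..<2 * K}. q ^ m) \<le> (\<Sum>m. q ^ m)"
      using \<open>q < 1\<close> \<open>q > 0\<close> by (intro sum_le_suminf summable_geometric) auto
    also have "\<dots> = 1 / (1 - q)" using \<open>q < 1\<close> \<open>q > 0\<close> by (intro suminf_geometric) auto
    finally show "(\<Sum>m\<in>{1..<2 * K}. q ^ m) \<le> 1 / (1 - q)" .
  qed (use \<open>q > 0\<close> in \<open>auto intro!: sum_nonneg\<close>)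
  finally show ?thesis .
qed

section \<open>An upper bound for the first eigenvalue\<close>

lemma first_eigenvalue_le:
  assumes "finite (dinterior \<Omega> \<delta>)" and "dinterior \<Omega> \<delta> \<noteq> {}"
    and "\<And>x. x \<notin> dinterior \<Omega> \<delta> \<Longrightarrow> f x = 0" and "x \<in> dinterior \<Omega> \<delta>" and "f x \<noteq> 0"
    and "dirichlet_form \<delta> (dinterior \<Omega> \<delta>) f f \<le> \<mu> * (\<Sum>x\<in>dinterior \<Omega> \<delta>. (f x)\<^sup>2)"
  shows "first_eigenvalue \<Omega> \<delta> \<le> \<mu>"
proof -
  have "(\<Sum>x\<in>dinterior \<Omega> \<delta>. (f x)\<^sup>2) > 0"
    using assms by (intro sum_pos2[of _ x]) auto
  moreover have "first_eigenvalue \<Omega> \<delta> * (\<Sum>x\<in>dinterior \<Omega> \<delta>. (f x)\<^sup>2) \<le> \<mu> * (\<Sum>x\<in>dinterior \<Omega> \<delta>. (f x)\<^sup>2)"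
    using first_eigenvalue_Rayleigh[OF assms(1,2), of f] assms(3,6) by fastforce
  ultimately show ?thesis by simp
qed

text \<open>
  If \<open>\<Omega>\<close> contains a cube of half-width \<open>r\<close>, the product of the cosines that vanish on its faces is a
  test function for lattice spacings below \<open>r\<close>; for coarser lattices the trivial bound for the
  discrete Laplacian suffices.
\<close>

lemma first_eigenvalue_le_cube:
  fixes \<Omega> :: "'a::euclidean_space set"
  assumes "\<delta> > 0" and fin: "finite (dinterior \<Omega> \<delta>)" and ne: "dinterior \<Omega> \<delta> \<noteq> {}"
    and "r > 0" and cube: "\<And>x. (\<And>b. b \<in> Basis \<Longrightarrow> \<bar>x \<bullet> b - c \<bullet> b\<bar> < r) \<Longrightarrow> x \<in> \<Omega>"
  shows "first_eigenvalue \<Omega> \<delta> \<le> 4 * real DIM('a) / r\<^sup>2"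
proof (cases "r \<le> \<delta>")
  case True
  obtain x0 where x0: "x0 \<in> dinterior \<Omega> \<delta>" using ne by blast
  let ?f = "\<lambda>x. if x = x0 then 1 else 0 :: real"
  have "dirichlet_form \<delta> (dinterior \<Omega> \<delta>) ?f ?f \<le> 4 * real DIM('a) / \<delta>\<^sup>2 * (\<Sum>x\<in>dinterior \<Omega> \<delta>. (?f x)\<^sup>2)"
    using fin by (rule dirichlet_form_le) (use x0 in auto)
  then have "first_eigenvalue \<Omega> \<delta> \<le> 4 * real DIM('a) / \<delta>\<^sup>2"
    by (rule first_eigenvalue_le[OF fin ne, of ?f x0, rotated 3]) (use x0 in auto)
  also have "\<dots> \<le> 4 * real DIM('a) / r\<^sup>2"
    using True \<open>r > 0\<close> by (intro divide_left_mono power_mono) auto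
  finally show ?thesis .
next
  case False
  define \<omega> where "\<omega> = pi / (2 * r)"
  have "\<omega> > 0" using \<open>r > 0\<close> by (simp add: \<omega>_def)
  define C where "C = {x \<in> grid \<delta>. \<forall>b\<in>Basis. \<bar>x \<bullet> b - c \<bullet> b\<bar> < r}"
  define f where "f = (\<lambda>x. if x \<in> C then \<Prod>b\<in>Basis. cos (\<omega> * (x \<bullet> b - c \<bullet> b)) else 0)"
  have C_sub: "C \<subseteq> dinterior \<Omega> \<delta>" using cube by (auto simp: C_def dinterior_def)
  have cos_pos: "cos (\<omega> * s) > 0" if "\<bar>s\<bar> < r" for s
  proof (rule cos_gt_zero_pi)
    have "\<omega> * \<bar>s\<bar> < \<omega> * r" using that \<open>\<omega> > 0\<close> by simp
    then have "\<bar>\<omega> * s\<bar> < pi / 2" using \<open>\<omega> > 0\<close> \<open>r > 0\<close> by (simp add: abs_mult \<omega>_def)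
    then show "- (pi / 2) < \<omega> * s" "\<omega> * s < pi / 2" by auto
  qed
  have cos_nonpos: "cos (\<omega> * s) \<le> 0" if "r \<le> \<bar>s\<bar>" "\<bar>s\<bar> \<le> 2 * r" for s
  proof -
    have "\<omega> * r \<le> \<omega> * \<bar>s\<bar>" "\<omega> * \<bar>s\<bar> \<le> \<omega> * (2 * r)" using that \<open>\<omega> > 0\<close> by simp_all
    then have "pi / 2 \<le> \<omega> * \<bar>s\<bar>" "\<omega> * \<bar>s\<bar> \<le> pi" using \<open>r > 0\<close> by (simp_all add: \<omega>_def)
    then have "0 \<le> cos (pi - \<omega> * \<bar>s\<bar>)" by (intro cos_ge_zero) auto
    then show ?thesis by (cases "s \<ge> 0") (simp_all add: cos_diff)
  qed
  have f_pos: "f x > 0" if "x \<in> C" for x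
    using that cos_pos by (auto simp: f_def C_def intro!: prod_pos)
  obtain x0 where "x0 \<in> C"
  proof
    let ?x = "\<Sum>b\<in>Basis. (\<delta> * of_int \<lfloor>c \<bullet> b / \<delta>\<rfloor>) *\<^sub>R b"
    have coord: "?x \<bullet> b = \<delta> * of_int \<lfloor>c \<bullet> b / \<delta>\<rfloor>" if "b \<in> Basis" for b
      using that by simp
    have "\<bar>?x \<bullet> b - c \<bullet> b\<bar> < r" if "b \<in> Basis" for b
    proof -
      have floor: "of_int \<lfloor>c \<bullet> b / \<delta>\<rfloor> \<le> c \<bullet> b / \<delta>" "c \<bullet> b / \<delta> < of_int \<lfloor>c \<bullet> b / \<delta>\<rfloor> + 1"
        by linarith+
      have "\<delta> * of_int \<lfloor>c \<bullet> b / \<delta>\<rfloor> \<le> c \<bullet> b" "c \<bullet> b < \<delta> * of_int \<lfloor>c \<bullet> b / \<delta>\<rfloor> + \<delta>"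
        using mult_left_mono[OF floor(1), of \<delta>] mult_strict_left_mono[OF floor(2), of \<delta>] \<open>\<delta> > 0\<close>
        by (simp_all add: distrib_left)
      then show ?thesis using False unfolding coord[OF that] by linarith
    qed
    moreover have "?x \<in> grid \<delta>" unfolding grid_def using coord by blast
    ultimately show "?x \<in> C" by (simp only: C_def mem_Collect_eq) blast
  qed
  have step: "f (x + \<delta> *\<^sub>R b) + f (x - \<delta> *\<^sub>R b) - 2 * f x \<ge> - ((\<omega> * \<delta>)\<^sup>2 * f x)"
    if x: "x \<in> C" and b: "b \<in> Basis" for x b
  proof -
    let ?rest = "\<Prod>d\<in>Basis - {b}. cos (\<omega> * (x \<bullet> d - c \<bullet> d))"
    have rest: "?rest \<ge> 0"
      using x cos_pos by (intro prod_nonneg) (auto simp: C_def less_imp_le)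
    \<comment> \<open>one step outside the cube the cosine is not positive, so the extension of \<open>f\<close> by zero only gains\<close>
    have nb: "f y \<ge> cos (\<omega> * (y \<bullet> b - c \<bullet> b)) * ?rest"
      if y: "y \<in> grid \<delta>" "\<And>d. d \<in> Basis - {b} \<Longrightarrow> y \<bullet> d = x \<bullet> d" "\<bar>y \<bullet> b - x \<bullet> b\<bar> \<le> \<delta>" for y
    proof (cases "y \<in> C")
      case True
      have "f y = cos (\<omega> * (y \<bullet> b - c \<bullet> b)) * (\<Prod>d\<in>Basis - {b}. cos (\<omega> * (y \<bullet> d - c \<bullet> d)))"
        using True b by (simp add: f_def prod.remove[of Basis b])
      then show ?thesis using y(2) by simp
    next
      case outside: False
      have "\<bar>x \<bullet> d - c \<bullet> d\<bar> < r" if "d \<in> Basis" for d using x that by (auto simp: C_def)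
      then have "r \<le> \<bar>y \<bullet> b - c \<bullet> b\<bar>"
        using outside y b by (auto simp: C_def) (metis DiffI not_less singletonD)
      moreover have "\<bar>y \<bullet> b - c \<bullet> b\<bar> \<le> 2 * r"
        using y(3) False \<open>\<And>d. d \<in> Basis \<Longrightarrow> \<bar>x \<bullet> d - c \<bullet> d\<bar> < r\<close>[OF b] by linarith
      ultimately have "cos (\<omega> * (y \<bullet> b - c \<bullet> b)) * ?rest \<le> 0"
        using cos_nonpos rest by (intro mult_nonpos_nonneg) auto
      then show ?thesis using outside by (simp add: f_def)
    qed
    have "x \<in> grid \<delta>" using x by (simp add: C_def)
    define s where "s = x \<bullet> b - c \<bullet> b"
    have fx: "f x = cos (\<omega> * s) * ?rest"
      using x b by (simp add: f_def s_def prod.remove[of Basis b])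
    have "f (x + \<delta> *\<^sub>R b) \<ge> cos (\<omega> * ((x + \<delta> *\<^sub>R b) \<bullet> b - c \<bullet> b)) * ?rest"
      by (rule nb) (use b \<open>\<delta> > 0\<close> grid_plus[OF \<open>x \<in> grid \<delta>\<close> b] in \<open>auto simp: inner_simps inner_Basis\<close>)
    moreover have "(x + \<delta> *\<^sub>R b) \<bullet> b - c \<bullet> b = s + \<delta>" using b by (simp add: inner_simps s_def)
    moreover have "f (x - \<delta> *\<^sub>R b) \<ge> cos (\<omega> * ((x - \<delta> *\<^sub>R b) \<bullet> b - c \<bullet> b)) * ?rest"
      by (rule nb) (use b \<open>\<delta> > 0\<close> grid_minus[OF \<open>x \<in> grid \<delta>\<close> b] in \<open>auto simp: inner_simps inner_Basis\<close>)
    moreover have "(x - \<delta> *\<^sub>R b) \<bullet> b - c \<bullet> b = s - \<delta>" using b by (simp add: inner_simps s_def)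
    ultimately have "f (x + \<delta> *\<^sub>R b) + f (x - \<delta> *\<^sub>R b) \<ge> cos (\<omega> * (s + \<delta>)) * ?rest + cos (\<omega> * (s - \<delta>)) * ?rest"
      by simp
    also have "cos (\<omega> * (s + \<delta>)) * ?rest + cos (\<omega> * (s - \<delta>)) * ?rest = 2 * cos (\<omega> * \<delta>) * f x"
      unfolding fx by (simp add: distrib_left right_diff_distrib cos_add cos_diff left_diff_distrib distrib_right)
    finally have "2 * (1 - cos (\<omega> * \<delta>)) * f x \<ge> - (f (x + \<delta> *\<^sub>R b) + f (x - \<delta> *\<^sub>R b) - 2 * f x)"
      by (simp add: algebra_simps)
    moreover have "2 * (1 - cos (\<omega> * \<delta>)) * f x \<le> (\<omega> * \<delta>)\<^sup>2 * f x"
      using one_minus_cos_le[of "\<omega> * \<delta>"] f_pos[OF x] by (intro mult_right_mono) auto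
    ultimately show ?thesis by linarith
  qed
  have form_le: "dirichlet_form \<delta> (dinterior \<Omega> \<delta>) f f \<le> real DIM('a) * \<omega>\<^sup>2 * (\<Sum>x\<in>dinterior \<Omega> \<delta>. (f x)\<^sup>2)"
    unfolding dirichlet_form_def sum_distrib_left
  proof (rule sum_mono)
    fix x
    show "f x * - dlaplacian \<delta> f x \<le> real DIM('a) * \<omega>\<^sup>2 * (f x)\<^sup>2"
    proof (cases "x \<in> C")
      case True
      have "(\<Sum>b\<in>(Basis::'a set). - ((\<omega> * \<delta>)\<^sup>2 * f x)) \<le> (\<Sum>b\<in>Basis. f (x + \<delta> *\<^sub>R b) + f (x - \<delta> *\<^sub>R b) - 2 * f x)"
        by (intro sum_mono step True)
      then have "- (real DIM('a) * \<omega>\<^sup>2 * f x) \<le> dlaplacian \<delta> f x"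
        using \<open>\<delta> > 0\<close> by (simp add: dlaplacian_eq_sum_second_differences pos_le_divide_eq power_mult_distrib algebra_simps)
      then have "f x * - dlaplacian \<delta> f x \<le> f x * (real DIM('a) * \<omega>\<^sup>2 * f x)"
        using f_pos[OF True] by (intro mult_left_mono) auto
      then show ?thesis by (simp add: power2_eq_square algebra_simps)
    qed (simp add: f_def)
  qed
  have "first_eigenvalue \<Omega> \<delta> \<le> real DIM('a) * \<omega>\<^sup>2"
  proof (rule first_eigenvalue_le[OF fin ne _ _ _ form_le])
    show "f x = 0" if "x \<notin> dinterior \<Omega> \<delta>" for x using that C_sub by (auto simp: f_def)
    show "x0 \<in> dinterior \<Omega> \<delta>" using C_sub \<open>x0 \<in> C\<close> by blast
    show "f x0 \<noteq> 0" using f_pos[OF \<open>x0 \<in> C\<close>] by simp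
  qed
  also have "\<omega>\<^sup>2 \<le> 4 / r\<^sup>2"
  proof -
    have "pi\<^sup>2 \<le> 4\<^sup>2" using pi_less_4 by (intro power_mono) auto
    then show ?thesis using \<open>r > 0\<close> by (simp add: \<omega>_def power_divide power_mult_distrib field_simps)
  qed
  finally show ?thesis by (simp add: mult.commute)
qed


section \<open>The finite cylinder\<close>

lemma first_rate_le_sqrt:
  assumes "\<delta> > 0" and "0 \<le> first_eigenvalue \<Omega> \<delta>" and "first_eigenvalue \<Omega> \<delta> \<le> \<Lambda>"
  shows "first_rate \<Omega> \<delta> \<le> sqrt \<Lambda>"
proof (rule real_le_rsqrt)
  have "1 + (first_rate \<Omega> \<delta> * \<delta>)\<^sup>2 / 2 \<le> 1 + \<delta>\<^sup>2 * first_eigenvalue \<Omega> \<delta> / 2"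
    using cosh_ge_one_plus_square[of "first_rate \<Omega> \<delta> * \<delta>"] cosh_first_rate[OF assms(1,2)] by simp
  then have "\<delta>\<^sup>2 * (first_rate \<Omega> \<delta>)\<^sup>2 \<le> \<delta>\<^sup>2 * first_eigenvalue \<Omega> \<delta>"
    by (simp add: power_mult_distrib mult.commute)
  then show "(first_rate \<Omega> \<delta>)\<^sup>2 \<le> \<Lambda>" using assms by simp
qed

text \<open>
  The first eigenvalue gives the exact exponential rate for the slice norms at heights \<open>1\<close> and \<open>- 1\<close>, and the
  sine series over the height \<open>1\<close> turns the slice norms into a pointwise bound in the middle.  The
  number of lattice points of \<open>\<Omega>\<close>, at most \<open>(2 K)\<^sup>n\<close>, cancels the factor \<open>K\<^sup>-\<^sup>n\<close> of the series, and
  the bound for the first eigenvalue controls the loss \<open>cosh a\<close> between the heights \<open>0\<close> and \<open>1\<close>.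
\<close>

lemma finite_cylinder_upper:
  fixes \<Omega> :: "'a::euclidean_space set" and h :: "'a \<times> real \<Rightarrow> real" and L N :: nat
  assumes "\<delta> > 0" and "1 / \<delta> \<in> \<nat>" and "N > 0" and "L > 0"
    and box: "\<And>x b. x \<in> \<Omega> \<Longrightarrow> b \<in> Basis \<Longrightarrow> \<bar>x \<bullet> b\<bar> < real L"
    and "r > 0" and cube: "\<And>x. (\<And>b. b \<in> Basis \<Longrightarrow> \<bar>x \<bullet> b - c \<bullet> b\<bar> < r) \<Longrightarrow> x \<in> \<Omega>"
    and harmonic: "dharmonic_on \<delta> h (dinterior \<Omega> \<delta> \<times> ({- real N<..<real N} \<inter> grid \<delta>))"
    and lateral: "\<And>y t. y \<in> dboundary \<Omega> \<delta> \<Longrightarrow> t \<in> grid \<delta> \<Longrightarrow> \<bar>t\<bar> \<le> real N \<Longrightarrow> h (y, t) \<le> F"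
    and ends: "\<And>x. x \<in> dinterior \<Omega> \<delta> \<Longrightarrow> h (x, real N) \<le> M \<and> h (x, - real N) \<le> M"
    and "F \<ge> 0" and "M \<ge> 0"
    and x: "x \<in> dinterior \<Omega> \<delta>"
  defines "q \<equiv> exp (- (pi / (8 * real L * real DIM('a))))"
  shows "h (x, 0) \<le> F + 8 * 2 ^ DIM('a) * (1 / (1 - q)) ^ DIM('a) * exp (sqrt (4 * real DIM('a) / r\<^sup>2))
    * M * exp (- first_rate \<Omega> \<delta> * real N)"
proof -
  define D where "D = dinterior \<Omega> \<delta>"
  define a where "a = first_rate \<Omega> \<delta>"
  define w where "w = excess D F h"
  obtain m :: nat where m: "1 / \<delta> = real m" using \<open>1 / \<delta> \<in> \<nat>\<close> by (auto elim: Nats_cases)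
  have "m > 0" using m \<open>\<delta> > 0\<close> by (cases m) auto
  have \<delta>m: "\<delta> * real m = 1" using m \<open>\<delta> > 0\<close> by (simp add: field_simps)
  \<comment> \<open>the half-width \<open>L\<close> of the cube is a whole number \<open>K\<close> of lattice steps since \<open>1 / \<delta>\<close> is an integer\<close>
  define K where "K = L * m"
  have "K > 0" and \<delta>K: "\<delta> * real K = real L"
    using \<open>L > 0\<close> \<open>m > 0\<close> \<delta>m by (simp_all add: K_def mult.left_commute)
  let ?Q = "cube_points \<delta> K :: 'a set"
  have D_sub: "D \<subseteq> ?Q" unfolding D_def by (rule dinterior_subset_cube_points) (simp add: \<delta>K box)
  have finQ: "finite ?Q" using finite_cube_points[OF \<open>\<delta> > 0\<close>] .
  then have finD: "finite D" using D_sub finite_subset by blast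
  have "D \<noteq> {}" using x by (auto simp: D_def)
  have nat_grid: "real i \<in> grid \<delta>" for i :: nat
    unfolding grid_real_iff by (rule exI[of _ "int (i * m)"]) (simp add: \<delta>m mult.left_commute)
  have w_nonneg: "w p \<ge> 0" for p by (simp add: w_def excess_nonneg)
  have w_outside: "w (y, t) = 0" if "y \<notin> D" for y t using that by (simp add: w_def excess_outside)
  have w_sub: "dlaplacian \<delta> w (y, t) \<ge> 0" if "y \<in> D" "t \<in> grid \<delta>" "\<bar>t\<bar> < real N" for y t
    unfolding w_def D_def
    by (rule excess_subharmonic) (use that harmonic lateral in \<open>auto simp: dharmonic_on_def D_def abs_less_iff\<close>)
  have w_end: "w (y, t) \<le> M" if "t = real N \<or> t = - real N" "y \<in> D" for y t
    using that ends[of y] \<open>F \<ge> 0\<close> \<open>M \<ge> 0\<close> by (auto simp: w_def excess_def D_def)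
  let ?k = "sqrt (real (card D)) * M / cosh (a * real N)"
  have E_end: "slice_norm D w t \<le> ?k * cosh (a * real N)" if "t = real N \<or> t = - real N" for t
  proof -
    have "slice_norm D w t \<le> L2_set (\<lambda>_. M) D"
      unfolding slice_norm_def by (rule L2_set_mono) (use w_end[OF that] w_nonneg in auto)
    also have "\<dots> = sqrt (real (card D)) * M" using \<open>M \<ge> 0\<close> by (simp add: L2_set_constant)
    finally show ?thesis by simp
  qed
  have E_le: "slice_norm D w t \<le> ?k * cosh (a * t)" if "t \<in> grid \<delta>" "\<bar>t\<bar> \<le> real N" for t
    unfolding D_def a_def
    by (rule slice_norm_le_cosh[where T = "real N"])
       (use \<open>\<delta> > 0\<close> finD \<open>D \<noteq> {}\<close> w_nonneg w_outside w_sub nat_grid[of N] E_end[of "real N"] E_end[of "- real N"] that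
        in \<open>simp_all add: D_def a_def\<close>)
  \<comment> \<open>one function dominating the data on both ends of the cylinder of half-height \<open>1\<close>, as the series needs\<close>
  define g where "g = (\<lambda>y. w (y, 1) + w (y, - 1))"
  have sum_le: "(\<Sum>y\<in>D. w (y, t)) \<le> real (card D) * M / cosh (a * real N) * cosh a" if "t = 1 \<or> t = - 1" for t
  proof -
    have "t \<in> grid \<delta>" "\<bar>t\<bar> \<le> real N"
      using that nat_grid[of 1] grid_real_uminus[OF nat_grid[of 1]] \<open>N > 0\<close> by auto
    have "(\<Sum>y\<in>D. w (y, t)) \<le> sqrt (real (card D)) * slice_norm D w t"
      using L2_set_mult_ineq[of "\<lambda>_. 1" "\<lambda>y. w (y, t)" D] w_nonneg
      by (simp add: slice_norm_def L2_set_constant)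
    also have "\<dots> \<le> sqrt (real (card D)) * (?k * cosh (a * t))"
      by (intro mult_left_mono E_le \<open>t \<in> grid \<delta>\<close> \<open>\<bar>t\<bar> \<le> real N\<close>) simp
    also have "\<dots> = (sqrt (real (card D)))\<^sup>2 * M / cosh (a * real N) * cosh a"
      using that by (auto simp: power2_eq_square)
    finally show ?thesis by simp
  qed
  let ?S = "\<Sum>k\<in>(mode_indices K :: ('a \<Rightarrow> nat) set). 1 / cosh (mode_rate \<delta> K k * 1)"
  have "w (x, 0) \<le> (1 / real K) ^ DIM('a) * ?S * (\<Sum>y\<in>?Q. g y)"
  proof (rule subharmonic_middle_bound[OF \<open>\<delta> > 0\<close> \<open>K > 0\<close>])
    show "(1::real) \<in> grid \<delta>" using nat_grid[of 1] by simp
    show "w (y, t) = 0" if "y \<notin> ?Q" for y t using that D_sub w_outside by blast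
    show "dlaplacian \<delta> w (y, t) \<ge> 0" if "t \<in> grid \<delta>" "\<bar>t\<bar> < 1" for y t
    proof (cases "y \<in> D")
      case True
      then show ?thesis using w_sub that \<open>N > 0\<close> by simp
    next
      case False
      have "dlaplacian \<delta> (\<lambda>_. 0) (y, t) \<le> dlaplacian \<delta> w (y, t)"
        by (rule dlaplacian_mono) (use w_outside[OF False] w_nonneg in auto)
      then show ?thesis by (simp add: dlaplacian_const)
    qed
    show "x \<in> ?Q" using x D_sub by (auto simp: D_def)
  qed (simp_all add: g_def w_nonneg)
  also have "(\<Sum>y\<in>?Q. g y) = (\<Sum>y\<in>D. w (y, 1)) + (\<Sum>y\<in>D. w (y, - 1))"
    unfolding sum.distrib[symmetric]
    by (rule sum.mono_neutral_cong_right[OF finQ D_sub]) (auto simp: g_def w_outside)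
  \<comment> \<open>of the factor \<open>4\<close>, one \<open>2\<close> counts the two ends and the other comes from \<open>1 / cosh s \<le> 2 exp (- s)\<close>\<close>
  also have "(1 / real K) ^ DIM('a) * ?S * ((\<Sum>y\<in>D. w (y, 1)) + (\<Sum>y\<in>D. w (y, - 1)))
      \<le> (1 / real K) ^ DIM('a) * (2 * (1 / (1 - q)) ^ DIM('a)) * (real (2 * K) ^ DIM('a) * (4 * M * exp a * exp (- a * real N)))"
  proof (intro mult_mono mult_left_mono)
    show "?S \<le> 2 * (1 / (1 - q)) ^ DIM('a)"
      using sum_inverse_cosh_mode_rate_le[OF \<open>\<delta> > 0\<close> \<open>K > 0\<close> zero_less_one] by (simp add: q_def \<delta>K)
    have "card D \<le> (2 * K) ^ DIM('a)"
      using card_mono[OF finQ D_sub] card_cube_points[OF \<open>\<delta> > 0\<close>, where K = K] by (rule order_trans)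
    then have card: "real (card D) \<le> real (2 * K) ^ DIM('a)" by (metis of_nat_le_iff of_nat_power)
    have "a \<ge> 0"
      using first_rate_nonneg[OF \<open>\<delta> > 0\<close> first_eigenvalue_nonneg[of \<Omega> \<delta>]] finD \<open>D \<noteq> {}\<close> by (simp add: a_def D_def)
    then have "cosh a \<le> exp a" by (simp add: cosh_def)
    have "(\<Sum>y\<in>D. w (y, 1)) + (\<Sum>y\<in>D. w (y, - 1))
        \<le> real (card D) * M / cosh (a * real N) * cosh a + real (card D) * M / cosh (a * real N) * cosh a"
      by (intro add_mono sum_le) auto
    also have "\<dots> = real (card D) * (2 * M * (1 / cosh (a * real N)) * cosh a)" by simp
    also have "\<dots> \<le> real (2 * K) ^ DIM('a) * (2 * M * (2 * exp (- (a * real N))) * exp a)"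
      using \<open>M \<ge> 0\<close> \<open>cosh a \<le> exp a\<close> inverse_cosh_le[of "a * real N"] card
      by (intro mult_mono mult_nonneg_nonneg) auto
    finally show "(\<Sum>y\<in>D. w (y, 1)) + (\<Sum>y\<in>D. w (y, - 1)) \<le> real (2 * K) ^ DIM('a) * (4 * M * exp a * exp (- a * real N))"
      by (simp add: mult_ac)
  qed (use \<open>L > 0\<close> in \<open>auto intro!: add_nonneg_nonneg sum_nonneg mult_nonneg_nonneg zero_le_power simp: w_nonneg q_def\<close>)
  also have "\<dots> = 8 * 2 ^ DIM('a) * (1 / (1 - q)) ^ DIM('a) * exp a * M * exp (- a * real N)"
    using \<open>K > 0\<close> by (simp add: power_mult_distrib power_divide field_simps)
  also have "\<dots> \<le> 8 * 2 ^ DIM('a) * (1 / (1 - q)) ^ DIM('a) * exp (sqrt (4 * real DIM('a) / r\<^sup>2)) * M * exp (- a * real N)"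
  proof (intro mult_right_mono mult_left_mono)
    have "first_eigenvalue \<Omega> \<delta> \<le> 4 * real DIM('a) / r\<^sup>2"
    proof (rule first_eigenvalue_le_cube[OF \<open>\<delta> > 0\<close> _ _ \<open>r > 0\<close>])
      show "x \<in> \<Omega>" if "\<And>b. b \<in> Basis \<Longrightarrow> \<bar>x \<bullet> b - c \<bullet> b\<bar> < r" for x
        using that by (rule cube)
    qed (use finD \<open>D \<noteq> {}\<close> in \<open>simp_all add: D_def\<close>)
    then show "exp a \<le> exp (sqrt (4 * real DIM('a) / r\<^sup>2))"
      using first_rate_le_sqrt[OF \<open>\<delta> > 0\<close> first_eigenvalue_nonneg[of \<Omega> \<delta>]] finD \<open>D \<noteq> {}\<close> by (simp add: a_def D_def)
  qed (use \<open>M \<ge> 0\<close> \<open>L > 0\<close> in \<open>auto simp: q_def\<close>)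
  finally have "w (x, 0) \<le> \<dots>" .
  moreover have "h (x, 0) - F \<le> w (x, 0)" using x by (simp add: w_def excess_def D_def)
  ultimately show ?thesis by (simp add: a_def)
qed

lemma open_contains_cube:
  fixes \<Omega> :: "'a::euclidean_space set"
  assumes "open \<Omega>" and "\<Omega> \<noteq> {}"
  obtains c r where "r > 0" and "\<And>x. (\<And>b. b \<in> Basis \<Longrightarrow> \<bar>x \<bullet> b - c \<bullet> b\<bar> < r) \<Longrightarrow> x \<in> \<Omega>"
proof -
  obtain c where "c \<in> \<Omega>" using assms by blast
  then obtain e where e: "e > 0" "ball c e \<subseteq> \<Omega>" using \<open>open \<Omega>\<close> open_contains_ball by blast
  show thesis
  proof (rule that[of "e / real DIM('a)" c])
    fix x assume x: "\<And>b. b \<in> Basis \<Longrightarrow> \<bar>x \<bullet> b - c \<bullet> b\<bar> < e / real DIM('a)"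
    have "norm (x - c) \<le> (\<Sum>b\<in>Basis. \<bar>(x - c) \<bullet> b\<bar>)" by (rule norm_le_l1)
    also have "\<dots> < (\<Sum>b\<in>(Basis::'a set). e / real DIM('a))"
      using x by (intro sum_strict_mono) (auto simp: inner_diff_left)
    finally have "x \<in> ball c e" by (simp add: dist_norm norm_minus_commute)
    then show "x \<in> \<Omega>" using e by blast
  qed (use e in simp)
qed

theorem cylinder_estimate:
  fixes \<Omega> :: "'a::euclidean_space set"
  assumes "open \<Omega>" and "\<Omega> \<noteq> {}" and "bounded \<Omega>"
  obtains C where "C > 0" and "\<And>\<delta> N M f h. \<delta> > 0 \<Longrightarrow> 1 / \<delta> \<in> \<nat> \<Longrightarrow> N > 0 \<Longrightarrow> dinterior \<Omega> \<delta> \<noteq> {} \<Longrightarrow>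
      dharmonic_on \<delta> h (dinterior \<Omega> \<delta> \<times> ({- real N<..<real N} \<inter> grid \<delta>)) \<Longrightarrow>
      (\<And>p. p \<in> dboundary \<Omega> \<delta> \<times> ({- real N..real N} \<inter> grid \<delta>) \<Longrightarrow> h p = f p) \<Longrightarrow>
      (\<And>x. x \<in> dinterior \<Omega> \<delta> \<Longrightarrow> \<bar>h (x, real N)\<bar> \<le> M \<and> \<bar>h (x, - real N)\<bar> \<le> M) \<Longrightarrow>
      Max ((\<lambda>x. \<bar>h (x, 0)\<bar>) ` dinterior \<Omega> \<delta>)
        \<le> Max ((\<lambda>p. \<bar>f p\<bar>) ` (dboundary \<Omega> \<delta> \<times> ({- real N..real N} \<inter> grid \<delta>)))
          + C * (M + Max ((\<lambda>p. \<bar>f p\<bar>) ` (dboundary \<Omega> \<delta> \<times> ({- real N..real N} \<inter> grid \<delta>))))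
            * exp (- first_rate \<Omega> \<delta> * real N)"
proof -
  obtain c r where r: "r > 0" and cube: "\<And>x. (\<And>b. b \<in> Basis \<Longrightarrow> \<bar>x \<bullet> b - c \<bullet> b\<bar> < r) \<Longrightarrow> x \<in> \<Omega>"
    using open_contains_cube[OF assms(1,2)] by metis
  obtain R where R: "\<And>x. x \<in> \<Omega> \<Longrightarrow> norm x \<le> R" using \<open>bounded \<Omega>\<close> by (auto simp: bounded_iff)
  obtain L :: nat where L: "max 0 R < real L" using reals_Archimedean2 by blast
  then have "L > 0" by auto
  have box: "\<bar>x \<bullet> b\<bar> < real L" if "x \<in> \<Omega>" "b \<in> Basis" for x b
    using Basis_le_norm[OF that(2), of x] R[OF that(1)] L by linarith
  define q where "q = exp (- (pi / (8 * real L * real DIM('a))))"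
  define C where "C = 8 * 2 ^ DIM('a) * (1 / (1 - q)) ^ DIM('a) * exp (sqrt (4 * real DIM('a) / r\<^sup>2))"
  have "q < 1" using \<open>L > 0\<close> by (simp add: q_def)
  then have "C > 0" by (simp add: C_def)
  show thesis
  proof (rule that[OF \<open>C > 0\<close>])
    fix \<delta> M :: real and N :: nat and f h :: "'a \<times> real \<Rightarrow> real"
    let ?D = "dinterior \<Omega> \<delta>"
    let ?P = "dboundary \<Omega> \<delta> \<times> ({- real N..real N} \<inter> grid \<delta>)"
    let ?F = "Max ((\<lambda>p. \<bar>f p\<bar>) ` ?P)"
    assume \<delta>: "\<delta> > 0" "1 / \<delta> \<in> \<nat>" and N: "N > 0" and ne: "?D \<noteq> {}"
      and harmonic: "dharmonic_on \<delta> h (?D \<times> ({- real N<..<real N} \<inter> grid \<delta>))"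
      and lateral: "\<And>p. p \<in> ?P \<Longrightarrow> h p = f p"
      and ends: "\<And>x. x \<in> ?D \<Longrightarrow> \<bar>h (x, real N)\<bar> \<le> M \<and> \<bar>h (x, - real N)\<bar> \<le> M"
    have fin: "finite ?D" using finite_dinterior[OF \<open>bounded \<Omega>\<close> \<delta>(1)] .
    have "{- real N..real N} \<inter> grid \<delta> = {t \<in> grid \<delta>. \<bar>t\<bar> \<le> real N}" by auto
    then have "finite ?P"
      using finite_dboundary[OF \<open>bounded \<Omega>\<close> \<delta>(1)] finite_grid_real[OF \<delta>(1), of "real N"] by simp
    then have f_le: "\<bar>f p\<bar> \<le> ?F" if "p \<in> ?P" for p using that by (intro Max_ge) auto
    obtain y where "y \<in> dboundary \<Omega> \<delta>" using dboundary_nonempty[OF fin ne \<delta>(1)] by blast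
    moreover have "(0::real) \<in> grid \<delta>" unfolding grid_real_iff by (metis mult_zero_right of_int_0)
    ultimately have "(y, 0) \<in> ?P" by simp
    from f_le[OF this] have "?F \<ge> 0" by linarith
    obtain z where "z \<in> ?D" using ne by blast
    from ends[OF this] have "M \<ge> 0" by linarith
    have h_lateral: "\<bar>h (y, t)\<bar> \<le> ?F" if "y \<in> dboundary \<Omega> \<delta>" "t \<in> grid \<delta>" "\<bar>t\<bar> \<le> real N" for y t
    proof -
      have "(y, t) \<in> ?P" using that by (simp add: abs_le_iff)
      from f_le[OF this] lateral[OF this] show ?thesis by simp
    qed
    have "\<bar>h (x, 0)\<bar> \<le> ?F + C * (M + ?F) * exp (- first_rate \<Omega> \<delta> * real N)" if x: "x \<in> ?D" for x
    proof -
      have up: "h (x, 0) \<le> ?F + C * M * exp (- first_rate \<Omega> \<delta> * real N)"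
        unfolding C_def q_def
      proof (rule finite_cylinder_upper[OF \<delta> N \<open>L > 0\<close> box r cube harmonic])
        show "h (y, t) \<le> ?F" if "y \<in> dboundary \<Omega> \<delta>" "t \<in> grid \<delta>" "\<bar>t\<bar> \<le> real N" for y t
          using h_lateral[OF that] by linarith
        show "h (x, real N) \<le> M \<and> h (x, - real N) \<le> M" if "x \<in> ?D" for x
          using ends[OF that] by linarith
      qed (use \<open>?F \<ge> 0\<close> \<open>M \<ge> 0\<close> x in auto)
      have down: "- h (x, 0) \<le> ?F + C * M * exp (- first_rate \<Omega> \<delta> * real N)"
        unfolding C_def q_def
      proof (rule finite_cylinder_upper[OF \<delta> N \<open>L > 0\<close> box r cube dharmonic_on_uminus[OF harmonic]])
        show "- h (y, t) \<le> ?F" if "y \<in> dboundary \<Omega> \<delta>" "t \<in> grid \<delta>" "\<bar>t\<bar> \<le> real N" for y t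
          using h_lateral[OF that] by linarith
        show "- h (x, real N) \<le> M \<and> - h (x, - real N) \<le> M" if "x \<in> ?D" for x
          using ends[OF that] by linarith
      qed (use \<open>?F \<ge> 0\<close> \<open>M \<ge> 0\<close> x in auto)
      have "C * M * exp (- first_rate \<Omega> \<delta> * real N) \<le> C * (M + ?F) * exp (- first_rate \<Omega> \<delta> * real N)"
        using \<open>C > 0\<close> \<open>?F \<ge> 0\<close> by (intro mult_right_mono mult_left_mono) auto
      with up down show ?thesis by linarith
    qed
    then show "Max ((\<lambda>x. \<bar>h (x, 0)\<bar>) ` ?D) \<le> ?F + C * (M + ?F) * exp (- first_rate \<Omega> \<delta> * real N)"
      using fin ne by (subst Max_le_iff) auto
  qed
qed

theorem phragmen_lindelof:
  fixes \<Omega> :: "'a::euclidean_space set" and h :: "'a \<times> real \<Rightarrow> real"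
  assumes "\<delta> > 0" and "bounded \<Omega>" and ne: "dinterior \<Omega> \<delta> \<noteq> {}"
    and harmonic: "dharmonic_on \<delta> h (dinterior \<Omega> \<delta> \<times> grid \<delta>)"
    and small: "\<And>\<epsilon>. \<epsilon> > 0 \<Longrightarrow> \<exists>R>0. \<forall>x \<in> dclosure \<Omega> \<delta>. \<forall>t \<in> grid \<delta>.
           \<bar>t\<bar> \<ge> R \<longrightarrow> \<bar>h (x, t)\<bar> \<le> \<epsilon> * exp (first_rate \<Omega> \<delta> * \<bar>t\<bar>)"
    and lateral: "\<And>p. p \<in> dboundary \<Omega> \<delta> \<times> grid \<delta> \<Longrightarrow> \<bar>h p\<bar> \<le> B"
    and p: "p \<in> dinterior \<Omega> \<delta> \<times> grid \<delta>"
  shows "\<bar>h p\<bar> \<le> B"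
proof -
  obtain x t where p': "p = (x, t)" "x \<in> dinterior \<Omega> \<delta>" "t \<in> grid \<delta>" using p by blast
  have fin: "finite (dinterior \<Omega> \<delta>)" using finite_dinterior[OF assms(2,1)] .
  \<comment> \<open>the discrete boundary is not empty, so \<open>B\<close> is nonnegative and the excess of \<open>h\<close> over \<open>B\<close> is at most \<open>\<bar>h\<bar>\<close>\<close>
  obtain y where "y \<in> dboundary \<Omega> \<delta>" using dboundary_nonempty[OF fin ne \<open>\<delta> > 0\<close>] by blast
  with lateral[of "(y, t)"] p' have "B \<ge> 0" by force
  have le: "h (x, t) \<le> B"
  proof (rule phragmen_lindelof_upper[OF \<open>\<delta> > 0\<close> fin ne \<open>B \<ge> 0\<close> harmonic _ _ p'(2,3)])
    show "\<exists>R>0. \<forall>x \<in> dinterior \<Omega> \<delta>. \<forall>t \<in> grid \<delta>. \<bar>t\<bar> \<ge> R \<longrightarrow> h (x, t) \<le> \<epsilon> * exp (first_rate \<Omega> \<delta> * \<bar>t\<bar>)"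
      if "\<epsilon> > 0" for \<epsilon>
      using small[OF that] abs_le_D1 unfolding dclosure_def by (meson UnI1)
    show "h (y, s) \<le> B" if "y \<in> dboundary \<Omega> \<delta>" "s \<in> grid \<delta>" for y s
      using lateral[of "(y, s)"] that by auto
  qed
  have ge: "- h (x, t) \<le> B"
  proof (rule phragmen_lindelof_upper[OF \<open>\<delta> > 0\<close> fin ne \<open>B \<ge> 0\<close> dharmonic_on_uminus[OF harmonic] _ _ p'(2,3)])
    show "\<exists>R>0. \<forall>x \<in> dinterior \<Omega> \<delta>. \<forall>t \<in> grid \<delta>. \<bar>t\<bar> \<ge> R \<longrightarrow> - h (x, t) \<le> \<epsilon> * exp (first_rate \<Omega> \<delta> * \<bar>t\<bar>)"
      if "\<epsilon> > 0" for \<epsilon>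
      using small[OF that] abs_le_D2 unfolding dclosure_def by (meson UnI1)
    show "- h (y, s) \<le> B" if "y \<in> dboundary \<Omega> \<delta>" "s \<in> grid \<delta>" for y s
      using lateral[of "(y, s)"] that by auto
  qed
  from le ge show ?thesis by (simp add: p'(1) abs_le_iff)
qed

lemma admissible_imp_nonempty:
  "admissible_threshold \<Omega> \<delta>\<^sub>0 \<Longrightarrow> 0 < \<delta> \<Longrightarrow> \<delta> < \<delta>\<^sub>0 \<Longrightarrow> dinterior \<Omega> \<delta> \<noteq> {}"
  by (auto simp: admissible_threshold_def)

theorem theorem5:
  fixes \<Omega> :: "(real ^ 'n) set"
  assumes "open \<Omega>" and "connected \<Omega>" and "\<Omega> \<noteq> {}" and "bounded \<Omega>"
    and "lipschitz_boundary \<Omega>"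
  shows
    "(\<exists>C>0. \<forall>\<delta>\<^sub>0 \<delta>. \<forall>N::nat. \<forall>M. \<forall>f h :: (real ^ 'n) \<times> real \<Rightarrow> real.
        admissible_threshold \<Omega> \<delta>\<^sub>0 \<longrightarrow> 0 < \<delta> \<longrightarrow> \<delta> < \<delta>\<^sub>0 \<longrightarrow> 1 / \<delta> \<in> \<nat> \<longrightarrow> N > 0 \<longrightarrow>
        dharmonic_on \<delta> h (dinterior \<Omega> \<delta> \<times> ({- real N<..<real N} \<inter> grid \<delta>)) \<longrightarrow>
        (\<forall>p \<in> dboundary \<Omega> \<delta> \<times> ({- real N..real N} \<inter> grid \<delta>). h p = f p) \<longrightarrow>
        (\<forall>x \<in> dinterior \<Omega> \<delta>. \<bar>h (x, real N)\<bar> \<le> M \<and> \<bar>h (x, - real N)\<bar> \<le> M) \<longrightarrow>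
        (let F = Max ((\<lambda>p. \<bar>f p\<bar>) ` (dboundary \<Omega> \<delta> \<times> ({- real N..real N} \<inter> grid \<delta>)))
         in Max ((\<lambda>x. \<bar>h (x, 0)\<bar>) ` dinterior \<Omega> \<delta>)
              \<le> F + C * (M + F) * exp (- first_rate \<Omega> \<delta> * real N)))
     \<and>
     (\<forall>\<delta>\<^sub>0 \<delta> B. \<forall>h :: (real ^ 'n) \<times> real \<Rightarrow> real.
        admissible_threshold \<Omega> \<delta>\<^sub>0 \<longrightarrow> 0 < \<delta> \<longrightarrow> \<delta> < \<delta>\<^sub>0 \<longrightarrow>
        dharmonic_on \<delta> h (dinterior \<Omega> \<delta> \<times> grid \<delta>) \<longrightarrow>
        (\<forall>\<epsilon>>0. \<exists>R>0. \<forall>x \<in> dclosure \<Omega> \<delta>. \<forall>t \<in> grid \<delta>.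
           \<bar>t\<bar> \<ge> R \<longrightarrow> \<bar>h (x, t)\<bar> \<le> \<epsilon> * exp (first_rate \<Omega> \<delta> * \<bar>t\<bar>)) \<longrightarrow>
        (\<forall>p \<in> dboundary \<Omega> \<delta> \<times> grid \<delta>. \<bar>h p\<bar> \<le> B) \<longrightarrow>
        (\<forall>p \<in> dinterior \<Omega> \<delta> \<times> grid \<delta>. \<bar>h p\<bar> \<le> B))"
proof (intro conjI)
  show "\<exists>C>0. \<forall>\<delta>\<^sub>0 \<delta>. \<forall>N::nat. \<forall>M. \<forall>f h :: (real ^ 'n) \<times> real \<Rightarrow> real.
        admissible_threshold \<Omega> \<delta>\<^sub>0 \<longrightarrow> 0 < \<delta> \<longrightarrow> \<delta> < \<delta>\<^sub>0 \<longrightarrow> 1 / \<delta> \<in> \<nat> \<longrightarrow> N > 0 \<longrightarrow>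
        dharmonic_on \<delta> h (dinterior \<Omega> \<delta> \<times> ({- real N<..<real N} \<inter> grid \<delta>)) \<longrightarrow>
        (\<forall>p \<in> dboundary \<Omega> \<delta> \<times> ({- real N..real N} \<inter> grid \<delta>). h p = f p) \<longrightarrow>
        (\<forall>x \<in> dinterior \<Omega> \<delta>. \<bar>h (x, real N)\<bar> \<le> M \<and> \<bar>h (x, - real N)\<bar> \<le> M) \<longrightarrow>
        (let F = Max ((\<lambda>p. \<bar>f p\<bar>) ` (dboundary \<Omega> \<delta> \<times> ({- real N..real N} \<inter> grid \<delta>)))
         in Max ((\<lambda>x. \<bar>h (x, 0)\<bar>) ` dinterior \<Omega> \<delta>)
              \<le> F + C * (M + F) * exp (- first_rate \<Omega> \<delta> * real N))"
    using \<open>open \<Omega>\<close> \<open>\<Omega> \<noteq> {}\<close> \<open>bounded \<Omega>\<close>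
  proof (rule cylinder_estimate)
    fix C :: real
    assume C: "C > 0" and est: "\<And>\<delta> N M f h. \<delta> > 0 \<Longrightarrow> 1 / \<delta> \<in> \<nat> \<Longrightarrow> N > 0 \<Longrightarrow> dinterior \<Omega> \<delta> \<noteq> {} \<Longrightarrow>
      dharmonic_on \<delta> h (dinterior \<Omega> \<delta> \<times> ({- real N<..<real N} \<inter> grid \<delta>)) \<Longrightarrow>
      (\<And>p. p \<in> dboundary \<Omega> \<delta> \<times> ({- real N..real N} \<inter> grid \<delta>) \<Longrightarrow> h p = f p) \<Longrightarrow>
      (\<And>x. x \<in> dinterior \<Omega> \<delta> \<Longrightarrow> \<bar>h (x, real N)\<bar> \<le> M \<and> \<bar>h (x, - real N)\<bar> \<le> M) \<Longrightarrow>
      Max ((\<lambda>x. \<bar>h (x, 0)\<bar>) ` dinterior \<Omega> \<delta>)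
        \<le> Max ((\<lambda>p. \<bar>f p\<bar>) ` (dboundary \<Omega> \<delta> \<times> ({- real N..real N} \<inter> grid \<delta>)))
          + C * (M + Max ((\<lambda>p. \<bar>f p\<bar>) ` (dboundary \<Omega> \<delta> \<times> ({- real N..real N} \<inter> grid \<delta>))))
            * exp (- first_rate \<Omega> \<delta> * real N)"
    show ?thesis
      unfolding Let_def
    proof (intro exI conjI allI impI, rule C, rule est)
      fix \<delta>\<^sub>0 \<delta> assume "admissible_threshold \<Omega> \<delta>\<^sub>0" "0 < \<delta>" "\<delta> < \<delta>\<^sub>0"
      then show "dinterior \<Omega> \<delta> \<noteq> {}" by (rule admissible_imp_nonempty)
    qed blast+
  qed
next
  show "\<forall>\<delta>\<^sub>0 \<delta> B. \<forall>h :: (real ^ 'n) \<times> real \<Rightarrow> real.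
        admissible_threshold \<Omega> \<delta>\<^sub>0 \<longrightarrow> 0 < \<delta> \<longrightarrow> \<delta> < \<delta>\<^sub>0 \<longrightarrow>
        dharmonic_on \<delta> h (dinterior \<Omega> \<delta> \<times> grid \<delta>) \<longrightarrow>
        (\<forall>\<epsilon>>0. \<exists>R>0. \<forall>x \<in> dclosure \<Omega> \<delta>. \<forall>t \<in> grid \<delta>.
           \<bar>t\<bar> \<ge> R \<longrightarrow> \<bar>h (x, t)\<bar> \<le> \<epsilon> * exp (first_rate \<Omega> \<delta> * \<bar>t\<bar>)) \<longrightarrow>
        (\<forall>p \<in> dboundary \<Omega> \<delta> \<times> grid \<delta>. \<bar>h p\<bar> \<le> B) \<longrightarrow>
        (\<forall>p \<in> dinterior \<Omega> \<delta> \<times> grid \<delta>. \<bar>h p\<bar> \<le> B)"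
  proof (intro allI impI ballI)
    fix \<delta>\<^sub>0 \<delta> B :: real and h :: "(real ^ 'n) \<times> real \<Rightarrow> real"
      and p :: "(real ^ 'n) \<times> real"
    assume \<delta>: "admissible_threshold \<Omega> \<delta>\<^sub>0" "0 < \<delta>" "\<delta> < \<delta>\<^sub>0"
      and harmonic: "dharmonic_on \<delta> h (dinterior \<Omega> \<delta> \<times> grid \<delta>)"
      and small: "\<forall>\<epsilon>>0. \<exists>R>0. \<forall>x \<in> dclosure \<Omega> \<delta>. \<forall>t \<in> grid \<delta>.
           \<bar>t\<bar> \<ge> R \<longrightarrow> \<bar>h (x, t)\<bar> \<le> \<epsilon> * exp (first_rate \<Omega> \<delta> * \<bar>t\<bar>)"
      and lateral: "\<forall>p \<in> dboundary \<Omega> \<delta> \<times> grid \<delta>. \<bar>h p\<bar> \<le> B"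
      and p: "p \<in> dinterior \<Omega> \<delta> \<times> grid \<delta>"
    have ne: "dinterior \<Omega> \<delta> \<noteq> {}" using \<delta> by (rule admissible_imp_nonempty)
    show "\<bar>h p\<bar> \<le> B"
    proof (rule phragmen_lindelof[OF \<delta>(2) \<open>bounded \<Omega>\<close> ne harmonic _ _ p])
      show "\<exists>R>0. \<forall>x \<in> dclosure \<Omega> \<delta>. \<forall>t \<in> grid \<delta>.
           \<bar>t\<bar> \<ge> R \<longrightarrow> \<bar>h (x, t)\<bar> \<le> \<epsilon> * exp (first_rate \<Omega> \<delta> * \<bar>t\<bar>)" if "\<epsilon> > 0" for \<epsilon>
        using small that by blast
      show "\<bar>h p\<bar> \<le> B" if "p \<in> dboundary \<Omega> \<delta> \<times> grid \<delta>" for p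
        using lateral that by blast
    qed
  qed
qed

end
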